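(* Let $F$ be the R. Thompson group, equipped with the word metric of a finite generating set. There exists an exponential function $D$ (i.e. $D(\lambda)=e^{\alpha\lambda}$ for some constant $\alpha>0$) such that the $D$-controlled dimension growth of $F$ is exponential, i.e. the function $\lambda\mapsto d_{D,F}(\lambda)=(\lambda,D(\lambda))\text{-dim}(F)$ has the same growth as $e^{\lambda}$.
   Context: The R. Thompson group $F$ is the group of piecewise linear orientation-preserving homeomorphisms of $[0,1]$ with finitely many breakpoints, all at dyadic rationals, and all slopes integer powers of $2$; it is generated by two elements $x_0,x_1$. Let $X$ be a metric space and $\lambda>0$. Two points $x,y$ of a set are $\lambda$-connected in it if there is a finite sequence of points of the set from $x$ to $y$ with consecutive distances at most $\lambda$; a set is a $\lambda$-cluster if every two of its points are $\lambda$-connected in it. For $\lambda,D>0$ we say $(\lambda,D)\text{-dim}(X)\le n$ if the points of $X$ can be colored in at most $n+1$ colors so that every monochromatic $\lambda$-cluster has diameter at most $D$; $(\lambda,D)\text{-dim}(X)$ is the smallest such $n$ ($\infty$ if there is none). For a function $D=D(\lambda)$ put $d_{D,X}(\lambda)=(\lambda,D(\lambda))\text{-dim}(X)$; its growth is the $D$-controlled dimension growth of $X$. Two functions $f,g$ on the positive reals have the same growth if there are constants $a,c>0$ with $f(at)\ge g(t)-c$ and $g(at)\ge f(t)-c$ for all $t$. *)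

theory Defs
  imports "HOL-Analysis.Analysis" "HOL-Algebra.Bij" "HOL-Algebra.Generated_Groups"
begin

text \<open>Thompson's group. Maps of $[0,1]$ are represented, as in \<^const>\<open>Bij\<close>, by functions on the
  reals that are undefined outside $[0,1]$. The product $fg$ is $f \circ g$; the opposite convention
  yields an anti-isomorphic group, and inversion is an isometry between the two word metrics.\<close>

definition dyadic_rationals :: "real set" where
  "dyadic_rationals = {of_int m / 2 ^ n | (m::int) (n::nat). True}"

text \<open>The set $P$ may contain points at which the slope does not change; the condition says that
  the actual breakpoints lie in $P$ and that $f$ is affine between consecutive points of $P$.\<close>

definition dyadic_piecewise_linear :: "(real \<Rightarrow> real) \<Rightarrow> bool" where
  "dyadic_piecewise_linear f \<longleftrightarrow>
    (\<exists>P. finite P \<and> {0, 1} \<subseteq> P \<and> P \<subseteq> {0..1} \<inter> dyadic_rationals \<and>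
      (\<forall>a\<in>P. \<forall>b\<in>P. a < b \<and> P \<inter> {a<..<b} = {} \<longrightarrow>
        (\<exists>(k::int) (c::real). \<forall>x\<in>{a..b}. f x = 2 powi k * x + c)))"

definition thompson_F :: "(real \<Rightarrow> real) monoid" where
  "thompson_F = (BijGroup {0..1})
     \<lparr>carrier := {f \<in> Bij {0..1}. (\<exists>g. homeomorphism {0..1} {0..1} f g) \<and>
                   strict_mono_on {0..1} f \<and> dyadic_piecewise_linear f}\<rparr>"

definition word_length :: "('a, 'b) monoid_scheme \<Rightarrow> 'a set \<Rightarrow> 'a \<Rightarrow> nat" where
  "word_length G S g =
    (LEAST n. \<exists>ws. length ws = n \<and> set ws \<subseteq> S \<union> m_inv G ` S \<and> foldr (mult G) ws (one G) = g)"

definition word_dist :: "('a, 'b) monoid_scheme \<Rightarrow> 'a set \<Rightarrow> 'a \<Rightarrow> 'a \<Rightarrow> real" where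
  "word_dist G S g h = real (word_length G S (inv\<^bsub>G\<^esub> g \<otimes>\<^bsub>G\<^esub> h))"

text \<open>Metric spaces are given by a carrier \<open>X\<close> and a distance function \<open>d\<close>,
  as in \<^locale>\<open>Metric_space\<close>; \<open>r\<close> is the scale $\lambda$.\<close>

definition scale_connected :: "('a \<Rightarrow> 'a \<Rightarrow> real) \<Rightarrow> real \<Rightarrow> 'a set \<Rightarrow> 'a \<Rightarrow> 'a \<Rightarrow> bool" where
  "scale_connected d r A x y \<longleftrightarrow>
    (\<exists>zs. zs \<noteq> [] \<and> hd zs = x \<and> last zs = y \<and> set zs \<subseteq> A \<and> successively (\<lambda>u v. d u v \<le> r) zs)"

definition scale_cluster :: "('a \<Rightarrow> 'a \<Rightarrow> real) \<Rightarrow> real \<Rightarrow> 'a set \<Rightarrow> bool" where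
  "scale_cluster d r A \<longleftrightarrow> (\<forall>x\<in>A. \<forall>y\<in>A. scale_connected d r A x y)"

text \<open>The extended-real supremum is used because the library's real-valued \<^const>\<open>diameter\<close> is
  not meaningful for unbounded sets.\<close>

definition set_diameter :: "('a \<Rightarrow> 'a \<Rightarrow> real) \<Rightarrow> 'a set \<Rightarrow> ereal" where
  "set_diameter d A = (SUP x\<in>A. SUP y\<in>A. ereal (d x y))"

definition scale_dim_le :: "'a set \<Rightarrow> ('a \<Rightarrow> 'a \<Rightarrow> real) \<Rightarrow> real \<Rightarrow> real \<Rightarrow> nat \<Rightarrow> bool" where
  "scale_dim_le X d r D n \<longleftrightarrow>
    (\<exists>colour :: 'a \<Rightarrow> nat. colour ` X \<subseteq> {..n} \<and>
      (\<forall>A\<subseteq>X. (\<forall>x\<in>A. \<forall>y\<in>A. colour x = colour y) \<and> scale_cluster d r A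
        \<longrightarrow> set_diameter d A \<le> ereal D))"

text \<open>The infimum of the empty set of extended naturals is \<open>\<infinity>\<close>.\<close>

definition scale_dim :: "'a set \<Rightarrow> ('a \<Rightarrow> 'a \<Rightarrow> real) \<Rightarrow> real \<Rightarrow> real \<Rightarrow> enat" where
  "scale_dim X d r D = Inf {enat n | n. scale_dim_le X d r D n}"

definition controlled_dim :: "'a set \<Rightarrow> ('a \<Rightarrow> 'a \<Rightarrow> real) \<Rightarrow> (real \<Rightarrow> real) \<Rightarrow> real \<Rightarrow> enat" where
  "controlled_dim X d D r = scale_dim X d r (D r)"

definition same_growth :: "(real \<Rightarrow> ereal) \<Rightarrow> (real \<Rightarrow> ereal) \<Rightarrow> bool" where
  "same_growth f g \<longleftrightarrow>
    (\<exists>a>0. \<exists>c>0. \<forall>t>0. f (a * t) \<ge> g t - ereal c \<and> g (a * t) \<ge> f t - ereal c)"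

end

theory Submission
  imports Defs
begin

text \<open>
  Upper bound: balls of radius \<open>r\<close> have at most exponentially many elements, so a greedy colouring
  with that many colours makes every monochromatic \<open>r\<close>-cluster a single point.

  Lower bound: two elements of $F$ shrink $[1/4, 3/4]$ to its left and right half. Conjugating a
  bump on $[1/4, 3/4]$ by the words of length $k$ in them gives $n = 2^k$ elements of word length
  $O(k)$ with disjoint supports. Their subproducts form a cube $\{0,1\}^n$ in $F$ in which flipping
  a coordinate moves a point by $O(k)$, while points that differ in $m$ coordinates have distance at
  least a constant times $m$, because they differ by an element with at least $m$ breakpoints.
  Suppose that the cube is coloured with $N$ colours so that points of equal colour at Hamming
  distance 2 always lie in one cluster, and all points of a cluster differ from a base point
  \<open>\<rho>\<close> of the cluster in at most $R$ coordinates. Among the $2^n n$ pairs of a point $y$ and a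
  direction $i$, at least $2^n (n - R)$ have $y$ equal to \<open>\<rho>\<close> in coordinate $i$. Map such a pair to the
  flipped point and the colour of $y$. All pairs with the same image have the same base point,
  from which the flipped point differs in at most $R + 1$ coordinates, among them all the
  directions $i$; so the map is at most $(R + 1)$-to-one and $n - R \le N (R + 1)$. If $R$ is about
  $n^{1/4}$, then $N$ is exponential in $k$.
\<close>

section \<open>Piecewise linear maps and Thompson's group\<close>

text \<open>The ends \<open>a\<close>, \<open>b\<close> range over all of [0,1] rather than over
  \<open>P\<close>, so \<open>P\<close> may be empty and may be enlarged at will. A finite
  \<open>P\<close> bounds the number of interior breakpoints by \<open>card P\<close>.\<close>

definition affine_off :: "real set \<Rightarrow> (real \<Rightarrow> real) \<Rightarrow> bool" where
  "affine_off P f \<longleftrightarrow>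
    (\<forall>a\<in>{0..1}. \<forall>b\<in>{0..1}. a < b \<and> P \<inter> {a<..<b} = {} \<longrightarrow>
      (\<exists>(k::int) (c::real). \<forall>x\<in>{a..b}. f x = 2 powi k * x + c))"

lemma affine_offD:
  assumes "affine_off P f" "a \<in> {0..1}" "b \<in> {0..1}" "a < b" "P \<inter> {a<..<b} = {}"
  obtains k :: int and c :: real where "\<And>x. x \<in> {a..b} \<Longrightarrow> f x = 2 powi k * x + c"
  using assms unfolding affine_off_def by meson

text \<open>As 0 and 1 lie in \<open>P\<close>, an interval without points of \<open>P\<close>
  inside lies between two consecutive points of \<open>P\<close> and inherits their affine
  formula.\<close>

lemma dyadic_piecewise_linear_iff:
  "dyadic_piecewise_linear f \<longleftrightarrow>
    (\<exists>P. finite P \<and> {0, 1} \<subseteq> P \<and> P \<subseteq> {0..1} \<inter> dyadic_rationals \<and> affine_off P f)"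
proof
  assume "dyadic_piecewise_linear f"
  then obtain P where P: "finite P" "{0, 1} \<subseteq> P" "P \<subseteq> {0..1} \<inter> dyadic_rationals"
    and aff: "\<forall>a\<in>P. \<forall>b\<in>P. a < b \<and> P \<inter> {a<..<b} = {} \<longrightarrow>
        (\<exists>(k::int) (c::real). \<forall>x\<in>{a..b}. f x = 2 powi k * x + c)"
    unfolding dyadic_piecewise_linear_def by blast
  have "affine_off P f"
    unfolding affine_off_def
  proof (intro ballI impI)
    fix a b :: real
    assume ab: "a \<in> {0..1}" "b \<in> {0..1}" and "a < b \<and> P \<inter> {a<..<b} = {}"
    then have lt: "a < b" and empty: "P \<inter> {a<..<b} = {}" by auto
    define a' where "a' = Max (P \<inter> {..a})"
    define b' where "b' = Min (P \<inter> {b..})"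
    have fin: "finite (P \<inter> {..a})" "finite (P \<inter> {b..})" using P by auto
    have "0 \<in> P \<inter> {..a}" "1 \<in> P \<inter> {b..}" using P ab by auto
    then have a': "a' \<in> P \<inter> {..a}" and b': "b' \<in> P \<inter> {b..}"
      unfolding a'_def b'_def using fin Max_in Min_in by (metis empty_iff)+
    have "P \<inter> {a'<..<b'} = {}"
    proof (rule ccontr)
      assume "P \<inter> {a'<..<b'} \<noteq> {}"
      then obtain p where p: "p \<in> P" "a' < p" "p < b'" by auto
      have "a < p" using p fin unfolding a'_def by (metis IntI Max_ge atMost_iff leD linorder_le_less_linear)
      moreover have "p < b" using p fin unfolding b'_def by (metis IntI Min_le atLeast_iff leD linorder_le_less_linear)
      ultimately show False using empty p by auto
    qed
    then obtain k :: int and c :: real where "\<forall>x\<in>{a'..b'}. f x = 2 powi k * x + c"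
      using aff a' b' lt by (metis IntD1 IntD2 atLeast_iff atMost_iff le_less_trans less_le_trans)
    then show "\<exists>(k::int) (c::real). \<forall>x\<in>{a..b}. f x = 2 powi k * x + c"
      using a' b' by (intro exI[of _ k] exI[of _ c]) auto
  qed
  with P show "\<exists>P. finite P \<and> {0, 1} \<subseteq> P \<and> P \<subseteq> {0..1} \<inter> dyadic_rationals \<and> affine_off P f"
    by blast
next
  assume "\<exists>P. finite P \<and> {0, 1} \<subseteq> P \<and> P \<subseteq> {0..1} \<inter> dyadic_rationals \<and> affine_off P f"
  then obtain P where P: "finite P" "{0, 1} \<subseteq> P" "P \<subseteq> {0..1} \<inter> dyadic_rationals"
    "affine_off P f" by blast
  then have "P \<subseteq> {0..1}" by blast
  with P show "dyadic_piecewise_linear f"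
    unfolding dyadic_piecewise_linear_def affine_off_def by (intro exI[of _ P]) blast
qed

text \<open>By monotonicity \<open>g\<close> maps a gap of the new set onto a gap of
  \<open>P\<close>, so slopes multiply. Only preimages of points of \<open>P\<close> are added to
  \<open>Q\<close>, and \<open>g\<close> is injective; hence breakpoint counts are
  subadditive.\<close>

lemma affine_off_compose:
  assumes f: "affine_off P f" and g: "affine_off Q g"
    and mono: "strict_mono_on {0..1} g" and surj: "g ` {0..1} = {0..1}"
  shows "affine_off (Q \<union> (g -` P \<inter> {0..1})) (compose {0..1} f g)"
  unfolding affine_off_def
proof (intro ballI impI)
  fix a b :: real
  assume ab: "a \<in> {0..1}" "b \<in> {0..1}" and "a < b \<and> (Q \<union> (g -` P \<inter> {0..1})) \<inter> {a<..<b} = {}"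
  then have lt: "a < b" and eQ: "Q \<inter> {a<..<b} = {}" and eP: "(g -` P \<inter> {0..1}) \<inter> {a<..<b} = {}"
    by auto
  obtain k :: int and c :: real where k: "\<And>x. x \<in> {a..b} \<Longrightarrow> g x = 2 powi k * x + c"
    using affine_offD[OF g ab lt eQ] by metis
  have gab: "g a \<in> {0..1}" "g b \<in> {0..1}" "g a < g b"
    using surj ab lt mono unfolding strict_mono_on_def by auto
  have "P \<inter> {g a<..<g b} = {}"
  proof (rule ccontr)
    assume "P \<inter> {g a<..<g b} \<noteq> {}"
    then obtain p where p: "p \<in> P" "g a < p" "p < g b" by auto
    then have "p \<in> g ` {0..1}" using gab surj by auto
    then obtain x where x: "x \<in> {0..1}" "g x = p" by auto
    have "a < x" "x < b"
      using p x ab strict_mono_on_less[OF mono] by blast+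
    then show False using eP p x by auto
  qed
  then obtain l :: int and e :: real where l: "\<And>y. y \<in> {g a..g b} \<Longrightarrow> f y = 2 powi l * y + e"
    using affine_offD[OF f gab] by metis
  have "compose {0..1} f g x = 2 powi (l + k) * x + (2 powi l * c + e)" if x: "x \<in> {a..b}" for x
  proof -
    have x01: "x \<in> {0..1}" using x ab by auto
    then have "g x \<in> {g a..g b}"
      using x ab strict_mono_on_leD[OF mono] by auto
    then have "f (g x) = 2 powi l * (2 powi k * x + c) + e" using l k[OF x] by metis
    then show ?thesis
      using x01 by (simp add: compose_eq power_int_add algebra_simps)
  qed
  then show "\<exists>(k::int) (c::real). \<forall>x\<in>{a..b}. compose {0..1} f g x = 2 powi k * x + c" by blast
qed

section \<open>Arithmetic of dyadic rationals\<close>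

lemma dyadic_rationals_add:
  assumes "x \<in> dyadic_rationals" "y \<in> dyadic_rationals"
  shows "x + y \<in> dyadic_rationals"
proof -
  obtain m n m' n' where "x = of_int m / 2 ^ n" "y = of_int m' / 2 ^ n'"
    using assms unfolding dyadic_rationals_def by auto
  then have "x + y = of_int (m * 2 ^ n' + m' * 2 ^ n) / 2 ^ (n + n')"
    by (simp add: add_divide_distrib power_add)
  then show ?thesis unfolding dyadic_rationals_def by blast
qed

lemma dyadic_rationals_uminus:
  assumes "x \<in> dyadic_rationals"
  shows "- x \<in> dyadic_rationals"
proof -
  obtain m n where "x = of_int m / 2 ^ n"
    using assms unfolding dyadic_rationals_def by auto
  then have "- x = of_int (- m) / 2 ^ n" by simp
  then show ?thesis unfolding dyadic_rationals_def by blast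
qed

lemma dyadic_rationals_diff:
  "x \<in> dyadic_rationals \<Longrightarrow> y \<in> dyadic_rationals \<Longrightarrow> x - y \<in> dyadic_rationals"
  using dyadic_rationals_add[of x "- y"] dyadic_rationals_uminus[of y] by simp

lemma dyadic_rationals_powi_mult:
  assumes "x \<in> dyadic_rationals"
  shows "2 powi (k::int) * x \<in> dyadic_rationals"
proof -
  obtain m n where x: "x = of_int m / 2 ^ n"
    using assms unfolding dyadic_rationals_def by auto
  show ?thesis
  proof (cases "k \<ge> 0")
    case True
    then have "2 powi k * x = of_int (m * 2 ^ nat k) / 2 ^ n"
      unfolding x by (simp add: power_int_def)
    then show ?thesis unfolding dyadic_rationals_def by blast
  next
    case False
    then have "2 powi k * x = of_int m / 2 ^ (n + nat (- k))"
      unfolding x by (simp add: power_int_def field_simps power_add)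
    then show ?thesis unfolding dyadic_rationals_def by blast
  qed
qed

lemma dyadic_rationalsI: "of_int m / 2 ^ n \<in> dyadic_rationals"
  unfolding dyadic_rationals_def by blast

lemma zero_dyadic [simp]: "0 \<in> dyadic_rationals"
  using dyadic_rationalsI[of 0 0] by simp

lemma one_dyadic [simp]: "1 \<in> dyadic_rationals"
  using dyadic_rationalsI[of 1 0] by simp

lemma thompson_F_carrier:
  "f \<in> carrier thompson_F \<longleftrightarrow> f \<in> Bij {0..1} \<and> (\<exists>g. homeomorphism {0..1} {0..1} f g) \<and>
     strict_mono_on {0..1} f \<and> dyadic_piecewise_linear f"
  unfolding thompson_F_def by simp

lemma thompson_F_mult:
  "f \<in> carrier thompson_F \<Longrightarrow> g \<in> carrier thompson_F \<Longrightarrow>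
    f \<otimes>\<^bsub>thompson_F\<^esub> g = compose {0..1} f g"
  unfolding thompson_F_def by (simp add: BijGroup_def)

lemma thompson_F_one: "\<one>\<^bsub>thompson_F\<^esub> = (\<lambda>x\<in>{0..1}. x)"
  unfolding thompson_F_def by (simp add: BijGroup_def)

lemma thompson_F_image:
  "f \<in> carrier thompson_F \<Longrightarrow> f ` {0..1} = {0..1}"
  using thompson_F_carrier unfolding Bij_def by (auto simp: bij_betw_def)

lemma thompson_F_strict_mono:
  "f \<in> carrier thompson_F \<Longrightarrow> strict_mono_on {0..1} f"
  using thompson_F_carrier by blast

section \<open>Dyadic breakpoints and the group structure\<close>

lemma strict_mono_on_unit_zero:
  fixes f :: "real \<Rightarrow> real"
  assumes "strict_mono_on {0..1} f" "f ` {0..1} = {0..1}"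
  shows "f 0 = 0"
proof -
  have "(0::real) \<in> f ` {0..1}" using assms by auto
  then obtain x where x: "x \<in> {0..1}" "f x = 0" by auto
  moreover have "f 0 \<in> {0..1}" using assms by auto
  ultimately show ?thesis using strict_mono_on_leD[OF assms(1), of 0 x] by auto
qed

text \<open>From one point of \<open>P\<close> to the next, \<open>f\<close> grows by a power of 2
  times a dyadic number, starting from 0. The proof compares a least counterexample \<open>b\<close>
  with its predecessor \<open>a\<close>.\<close>

lemma affine_off_dyadic_image:
  assumes P: "finite P" "{0, 1} \<subseteq> P" "P \<subseteq> {0..1} \<inter> dyadic_rationals" "affine_off P f"
    and f0: "f 0 = 0" and "p \<in> P"
  shows "f p \<in> dyadic_rationals"
proof (rule ccontr)
  assume "f p \<notin> dyadic_rationals"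
  define B where "B = {q\<in>P. f q \<notin> dyadic_rationals}"
  have B: "finite B" "B \<noteq> {}" using P \<open>p \<in> P\<close> \<open>f p \<notin> _\<close> unfolding B_def by auto
  define b where "b = Min B"
  have b: "b \<in> B" unfolding b_def using B by simp
  then have bP: "b \<in> P" "f b \<notin> dyadic_rationals" unfolding B_def by auto
  have "b \<noteq> 0" using bP f0 by auto
  then have "0 < b" using bP P by (metis IntD1 atLeastAtMost_iff order_le_less subsetD)
  define a where "a = Max (P \<inter> {..<b})"
  have fin: "finite (P \<inter> {..<b})" using P by auto
  have "0 \<in> P \<inter> {..<b}" using P \<open>0 < b\<close> by auto
  then have a: "a \<in> P \<inter> {..<b}" unfolding a_def using fin Max_in by (metis empty_iff)
  then have "a \<notin> B" unfolding b_def using B by (metis IntD2 Min_le b_def leD lessThan_iff)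
  then have fa: "f a \<in> dyadic_rationals" using a unfolding B_def by auto
  have "P \<inter> {a<..<b} = {}"
    using fin unfolding a_def by (auto dest: Max_ge[OF fin, OF IntI])
  moreover have "a \<in> {0..1}" "b \<in> {0..1}" "a < b" using a bP P by auto
  ultimately obtain k :: int and c :: real where "\<And>x. x \<in> {a..b} \<Longrightarrow> f x = 2 powi k * x + c"
    using affine_offD[OF P(4)] by metis
  then have "f b = f a + 2 powi k * (b - a)"
    using \<open>a < b\<close> by (simp add: algebra_simps)
  moreover have "a \<in> dyadic_rationals" "b \<in> dyadic_rationals" using a bP P by auto
  ultimately show False
    using fa bP by (simp add: dyadic_rationals_add dyadic_rationals_diff dyadic_rationals_powi_mult)
qed

text \<open>On the affine piece that starts at the last point \<open>a\<close> of \<open>P\<close>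
  before \<open>x\<close>, solving for \<open>x\<close> gives \<open>a\<close> plus a power of 2
  times a difference of dyadic values. Hence breakpoints pulled back along \<open>f\<close> stay
  dyadic.\<close>

lemma affine_off_dyadic_preimage:
  assumes P: "finite P" "{0, 1} \<subseteq> P" "P \<subseteq> {0..1} \<inter> dyadic_rationals" "affine_off P f"
    and f0: "f 0 = 0" and x: "x \<in> {0..1}" and fx: "f x \<in> dyadic_rationals"
  shows "x \<in> dyadic_rationals"
proof (cases "x = 0")
  case False
  then have "0 < x" using x by auto
  define a where "a = Max (P \<inter> {..<x})"
  have fin: "finite (P \<inter> {..<x})" using P by auto
  have "0 \<in> P \<inter> {..<x}" using P \<open>0 < x\<close> by auto
  then have a: "a \<in> P \<inter> {..<x}" unfolding a_def using fin Max_in by (metis empty_iff)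
  have "P \<inter> {a<..<x} = {}"
    using fin unfolding a_def by (auto dest: Max_ge[OF fin, OF IntI])
  moreover have "a \<in> {0..1}" "a < x" using a P by auto
  ultimately obtain k :: int and c :: real where "\<And>y. y \<in> {a..x} \<Longrightarrow> f y = 2 powi k * y + c"
    using affine_offD[OF P(4)] x by metis
  then have "f x - f a = 2 powi k * (x - a)"
    using \<open>a < x\<close> by (simp add: algebra_simps)
  then have "x = a + 2 powi (- k) * (f x - f a)"
    by (simp add: power_int_minus field_simps)
  moreover have "a \<in> dyadic_rationals" using a P by auto
  moreover have "f a \<in> dyadic_rationals"
    using affine_off_dyadic_image[OF P f0] a by auto
  ultimately show ?thesis
    using fx by (metis dyadic_rationals_add dyadic_rationals_diff dyadic_rationals_powi_mult)
qed simp

lemma dyadic_piecewise_linear_compose: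
  assumes f: "dyadic_piecewise_linear f" and g: "dyadic_piecewise_linear g"
    and mono: "strict_mono_on {0..1} g" and surj: "g ` {0..1} = {0..1}"
  shows "dyadic_piecewise_linear (compose {0..1} f g)"
proof -
  obtain P where P: "finite P" "{0, 1} \<subseteq> P" "P \<subseteq> {0..1} \<inter> dyadic_rationals" "affine_off P f"
    using f unfolding dyadic_piecewise_linear_iff by blast
  obtain Q where Q: "finite Q" "{0, 1} \<subseteq> Q" "Q \<subseteq> {0..1} \<inter> dyadic_rationals" "affine_off Q g"
    using g unfolding dyadic_piecewise_linear_iff by blast
  have g0: "g 0 = 0" using strict_mono_on_unit_zero[OF mono surj] .
  have "g -` P \<inter> {0..1} \<subseteq> {0..1} \<inter> dyadic_rationals"
    using affine_off_dyadic_preimage[OF Q g0] P by auto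
  moreover have "finite (g -` P \<inter> {0..1})"
    using P mono by (intro finite_vimage_IntI strict_mono_on_imp_inj_on)
  ultimately show ?thesis
    unfolding dyadic_piecewise_linear_iff
    using affine_off_compose[OF P(4) Q(4) mono surj] Q
    by (intro exI[of _ "Q \<union> (g -` P \<inter> {0..1})"]) auto
qed

text \<open>The inverse breaks only at the images of breakpoints, which are dyadic, and its slopes
  are the reciprocal powers of 2.\<close>

lemma dyadic_piecewise_linear_inverse:
  assumes f: "dyadic_piecewise_linear f"
    and mono: "strict_mono_on {0..1} f" and surj: "f ` {0..1} = {0..1}"
    and inv: "\<And>x. x \<in> {0..1} \<Longrightarrow> g (f x) = x"
  shows "dyadic_piecewise_linear g"
proof -
  obtain P where P: "finite P" "{0, 1} \<subseteq> P" "P \<subseteq> {0..1} \<inter> dyadic_rationals" "affine_off P f"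
    using f unfolding dyadic_piecewise_linear_iff by blast
  have f0: "f 0 = 0" using strict_mono_on_unit_zero[OF mono surj] .
  have "(1::real) \<in> f ` {0..1}" using surj by auto
  then obtain x where x: "x \<in> {0..1}" "f x = 1" by auto
  have "f 1 \<in> {0..1}" using surj by auto
  then have f1: "f 1 = 1" using x strict_mono_on_leD[OF mono, of x 1] by auto
  have sub: "f ` P \<subseteq> {0..1} \<inter> dyadic_rationals"
    using affine_off_dyadic_image[OF P f0] P(3) surj by blast
  have "affine_off (f ` P) g"
    unfolding affine_off_def
  proof (intro ballI impI)
    fix a b :: real
    assume ab: "a \<in> {0..1}" "b \<in> {0..1}" and *: "a < b \<and> f ` P \<inter> {a<..<b} = {}"
    then have "a \<in> f ` {0..1}" "b \<in> f ` {0..1}" using surj by auto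
    then obtain a' b' where a'b': "a' \<in> {0..1}" "b' \<in> {0..1}" "a = f a'" "b = f b'" by auto
    then have lt: "a' < b'" using * strict_mono_on_less[OF mono] by auto
    have "P \<inter> {a'<..<b'} = {}"
    proof (rule ccontr)
      assume "P \<inter> {a'<..<b'} \<noteq> {}"
      then obtain p where p: "p \<in> P" "a' < p" "p < b'" by auto
      then have "a < f p" "f p < b"
        using a'b' P strict_mono_on_less[OF mono] by auto
      then show False using * p by auto
    qed
    then obtain k :: int and c :: real where k: "\<And>x. x \<in> {a'..b'} \<Longrightarrow> f x = 2 powi k * x + c"
      using affine_offD[OF P(4) a'b'(1,2) lt] by metis
    have "g y = 2 powi (- k) * y + - (2 powi (- k) * c)" if y: "y \<in> {a..b}" for y
    proof -
      have "y \<in> f ` {0..1}" using y ab surj by auto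
      then obtain x where x: "x \<in> {0..1}" "y = f x" by auto
      then have "x \<in> {a'..b'}" using y a'b' strict_mono_on_less_eq[OF mono] by auto
      then have "y = 2 powi k * x + c" using k x by auto
      moreover have "g y = x" using inv x by auto
      ultimately show ?thesis by (simp add: power_int_minus field_simps)
    qed
    then show "\<exists>(k::int) (c::real). \<forall>x\<in>{a..b}. g x = 2 powi k * x + c" by blast
  qed
  then show ?thesis
    unfolding dyadic_piecewise_linear_iff
    using P(1,2) f0 f1 sub by (intro exI[of _ "f ` P"]) (auto intro: image_eqI[of _ f 0] image_eqI[of _ f 1])
qed

lemma thompson_F_subgroup: "subgroup (carrier thompson_F) (BijGroup {0..1})"
proof (rule group.subgroupI[OF group_BijGroup])
  show "carrier thompson_F \<subseteq> carrier (BijGroup {0..1})"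
    by (auto simp: thompson_F_carrier BijGroup_def)
  have "(\<lambda>x\<in>{0..1::real}. x) \<in> Bij {0..1}" by (rule id_Bij)
  moreover have "homeomorphism {0..1::real} {0..1} (\<lambda>x\<in>{0..1}. x) (\<lambda>x. x)"
    by (rule homeomorphism_cong[OF homeomorphism_ident]) auto
  moreover have "strict_mono_on {0..1::real} (\<lambda>x\<in>{0..1}. x)"
    by (auto simp: strict_mono_on_def)
  moreover have "dyadic_piecewise_linear (\<lambda>x\<in>{0..1}. x)"
    unfolding dyadic_piecewise_linear_def
    by (intro exI[of _ "{0,1}"]) (auto intro!: exI[of _ 0])
  ultimately have "(\<lambda>x\<in>{0..1::real}. x) \<in> carrier thompson_F"
    unfolding thompson_F_carrier by blast
  then show "carrier thompson_F \<noteq> {}" by blast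
next
  fix f assume f: "f \<in> carrier thompson_F"
  then obtain g where g: "homeomorphism {0..1} {0..1} f g" and fB: "f \<in> Bij {0..1}"
    and mono: "strict_mono_on {0..1} f" and pl: "dyadic_piecewise_linear f"
    unfolding thompson_F_carrier by blast
  define f' where "f' = (\<lambda>x\<in>{0..1}. inv_into {0..1} f x)"
  have inj: "inj_on f {0..1}" using mono by (rule strict_mono_on_imp_inj_on)
  have surj: "f ` {0..1} = {0..1}" using f by (rule thompson_F_image)
  have f'f: "f' (f x) = x" if "x \<in> {0..1}" for x
  proof -
    have "f x \<in> {0..1}" using surj that by blast
    then show ?thesis unfolding f'_def using inj that by simp
  qed
  have f'B: "f' \<in> Bij {0..1}" unfolding f'_def using fB by (rule restrict_inv_into_Bij)
  \<comment> \<open>The group inverse \<open>f'\<close> is the extensional version of the continuous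
    inverse \<open>g\<close>, so it inherits continuity from \<open>g\<close>.\<close>
  have "f' y = g y" if "y \<in> {0..1}" for y
  proof -
    have "y \<in> f ` {0..1}" using surj that by blast
    then show ?thesis using f'f g unfolding homeomorphism_def by force
  qed
  then have "homeomorphism {0..1} {0..1} f' f"
    using g by (intro homeomorphism_cong[OF homeomorphism_symD[OF g]]) auto
  moreover have "strict_mono_on {0..1} f'"
    unfolding strict_mono_on_def
  proof (intro allI impI)
    fix x y :: real assume xy: "x \<in> {0..1} \<and> y \<in> {0..1} \<and> x < y"
    then have "x \<in> f ` {0..1}" "y \<in> f ` {0..1}" using surj by auto
    then show "f' x < f' y" using f'f xy strict_mono_on_less[OF mono] by fastforce
  qed
  moreover have "dyadic_piecewise_linear f'"
    using dyadic_piecewise_linear_inverse[OF pl mono surj f'f] .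
  ultimately have "f' \<in> carrier thompson_F"
    unfolding thompson_F_carrier using f'B by blast
  then show "inv\<^bsub>BijGroup {0..1}\<^esub> f \<in> carrier thompson_F"
    using inv_BijGroup[OF fB] unfolding f'_def by simp
next
  fix f g assume fg: "f \<in> carrier thompson_F" "g \<in> carrier thompson_F"
  then have B: "f \<in> Bij {0..1}" "g \<in> Bij {0..1}"
    and mono: "strict_mono_on {0..1} f" "strict_mono_on {0..1} g"
    and surj: "f ` {0..1} = {0..1}" "g ` {0..1} = {0..1}"
    unfolding thompson_F_carrier Bij_def bij_betw_def by auto
  obtain f' g' where "homeomorphism {0..1} {0..1} f f'" "homeomorphism {0..1} {0..1} g g'"
    using fg unfolding thompson_F_carrier by blast
  then have "homeomorphism {0..1} {0..1} (f \<circ> g) (g' \<circ> f')"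
    by (metis homeomorphism_compose)
  then have "homeomorphism {0..1} {0..1} (compose {0..1} f g) (g' \<circ> f')"
    by (rule homeomorphism_cong) (auto simp: compose_def)
  moreover have "strict_mono_on {0..1} (compose {0..1} f g)"
  proof -
    have "g x \<in> {0..1}" if "x \<in> {0..1}" for x using that surj by blast
    then show ?thesis
      using mono unfolding strict_mono_on_def by (auto simp: compose_def)
  qed
  moreover have "dyadic_piecewise_linear (compose {0..1} f g)"
    using fg mono surj dyadic_piecewise_linear_compose unfolding thompson_F_carrier by blast
  ultimately show "f \<otimes>\<^bsub>BijGroup {0..1}\<^esub> g \<in> carrier thompson_F"
    using B compose_Bij[OF B] unfolding thompson_F_carrier by (simp add: BijGroup_def) blast
qed

lemma group_thompson_F: "group thompson_F"
  using subgroup.subgroup_is_group[OF thompson_F_subgroup group_BijGroup]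
  unfolding thompson_F_def by simp

section \<open>Word metrics and greedy colourings\<close>

context group
begin

lemma foldr_mult_closed:
  "set ws \<subseteq> carrier G \<Longrightarrow> foldr (\<otimes>) ws \<one> \<in> carrier G"
  by (induction ws) auto

lemma foldr_mult_append:
  "set ws \<subseteq> carrier G \<Longrightarrow> set vs \<subseteq> carrier G \<Longrightarrow>
    foldr (\<otimes>) (ws @ vs) \<one> = foldr (\<otimes>) ws \<one> \<otimes> foldr (\<otimes>) vs \<one>"
  by (induction ws) (auto simp: foldr_mult_closed m_assoc)

lemma foldr_mult_inv:
  "set ws \<subseteq> carrier G \<Longrightarrow>
    foldr (\<otimes>) (rev (map (m_inv G) ws)) \<one> = inv (foldr (\<otimes>) ws \<one>)"
proof (induction ws)
  case (Cons w ws)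
  then have "set (rev (map (m_inv G) ws)) \<subseteq> carrier G" by auto
  with Cons show ?case
    by (simp add: foldr_mult_append foldr_mult_closed inv_mult_group del: foldr_append)
qed simp

lemma letters_closed: "S \<subseteq> carrier G \<Longrightarrow> S \<union> m_inv G ` S \<subseteq> carrier G"
  by auto

text \<open>Without a word for each element the \<open>LEAST\<close> in \<open>word_length\<close>
  would be unspecified; generation supplies one.\<close>

lemma generate_imp_word:
  assumes "S \<subseteq> carrier G" "g \<in> generate G S"
  shows "\<exists>ws. set ws \<subseteq> S \<union> m_inv G ` S \<and> foldr (\<otimes>) ws \<one> = g"
  using assms(2)
proof (induction rule: generate.induct)
  case one
  then show ?case by (intro exI[of _ "[]"]) simp
next
  case (incl h)
  then show ?case using assms by (intro exI[of _ "[h]"]) auto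
next
  case (inv h)
  then show ?case using assms by (intro exI[of _ "[inv h]"]) auto
next
  case (eng h1 h2)
  then obtain vs ws where "set vs \<subseteq> S \<union> m_inv G ` S" "foldr (\<otimes>) vs \<one> = h1"
    "set ws \<subseteq> S \<union> m_inv G ` S" "foldr (\<otimes>) ws \<one> = h2" by blast
  moreover from this have "set vs \<subseteq> carrier G" "set ws \<subseteq> carrier G"
    using letters_closed[OF assms(1)] by blast+
  ultimately show ?case
    by (intro exI[of _ "vs @ ws"]) (auto simp: foldr_mult_append simp del: foldr_append)
qed

lemma word_length_le:
  "set ws \<subseteq> S \<union> m_inv G ` S \<Longrightarrow> word_length G S (foldr (\<otimes>) ws \<one>) \<le> length ws"
  unfolding word_length_def by (rule Least_le) blast

end

locale generated_group = group +
  fixes S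
  assumes S_carrier: "S \<subseteq> carrier G" and gen: "generate G S = carrier G"
begin

abbreviation "len \<equiv> word_length G S"

lemma obtain_shortest_word:
  assumes "g \<in> carrier G"
  obtains ws where "set ws \<subseteq> S \<union> m_inv G ` S" "set ws \<subseteq> carrier G" "foldr (\<otimes>) ws \<one> = g"
    "length ws = len g"
proof -
  have "\<exists>n ws. length ws = n \<and> set ws \<subseteq> S \<union> m_inv G ` S \<and> foldr (\<otimes>) ws \<one> = g"
    using generate_imp_word[OF S_carrier] assms gen by blast
  then have "\<exists>ws. length ws = len g \<and> set ws \<subseteq> S \<union> m_inv G ` S \<and> foldr (\<otimes>) ws \<one> = g"
    unfolding word_length_def by (rule LeastI_ex)
  then show ?thesis using that letters_closed[OF S_carrier] by blast
qed

lemma len_one [simp]: "len \<one> = 0"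
  using word_length_le[of "[]" S] by simp

lemma len_mult:
  assumes "g \<in> carrier G" "h \<in> carrier G"
  shows "len (g \<otimes> h) \<le> len g + len h"
proof -
  obtain vs ws where "set vs \<subseteq> S \<union> m_inv G ` S" "set vs \<subseteq> carrier G" "foldr (\<otimes>) vs \<one> = g"
    "length vs = len g" "set ws \<subseteq> S \<union> m_inv G ` S" "set ws \<subseteq> carrier G"
    "foldr (\<otimes>) ws \<one> = h" "length ws = len h"
    using assms obtain_shortest_word by metis
  then show ?thesis
    using word_length_le[of "vs @ ws" S] by (simp add: foldr_mult_append del: foldr_append)
qed

lemma len_inv:
  assumes "g \<in> carrier G"
  shows "len (inv g) = len g"
proof -
  \<comment> \<open>Applied to both \<open>g\<close> and \<open>inv g\<close>, this inequality
    yields equality.\<close>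
  have le: "len (inv h) \<le> len h" if h: "h \<in> carrier G" for h
  proof -
    obtain ws where ws: "set ws \<subseteq> S \<union> m_inv G ` S" "set ws \<subseteq> carrier G" "foldr (\<otimes>) ws \<one> = h"
      "length ws = len h"
      using h obtain_shortest_word by metis
    have "set (rev (map (m_inv G) ws)) \<subseteq> S \<union> m_inv G ` S"
    proof
      fix x assume "x \<in> set (rev (map (m_inv G) ws))"
      then obtain w where w: "w \<in> set ws" "x = inv w" by auto
      then have "w \<in> S \<union> m_inv G ` S" using ws(1) by blast
      then show "x \<in> S \<union> m_inv G ` S" using S_carrier w(2) by auto
    qed
    then show ?thesis
      using word_length_le[of "rev (map (m_inv G) ws)" S] ws by (simp only: foldr_mult_inv) simp
  qed
  from le[OF assms] le[of "inv g"] assms show ?thesis by simp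
qed

abbreviation "wdist \<equiv> word_dist G S"

lemma wdist_self: "g \<in> carrier G \<Longrightarrow> wdist g g = 0"
  unfolding word_dist_def by simp

lemma wdist_commute:
  assumes "g \<in> carrier G" "h \<in> carrier G"
  shows "wdist g h = wdist h g"
proof -
  have "inv g \<otimes> h = inv (inv h \<otimes> g)" using assms by (simp add: inv_mult_group)
  then show ?thesis unfolding word_dist_def using assms len_inv by simp
qed

lemma wdist_triangle:
  assumes "g \<in> carrier G" "h \<in> carrier G" "k \<in> carrier G"
  shows "wdist g k \<le> wdist g h + wdist h k"
proof -
  have "h \<otimes> (inv h \<otimes> k) = k" using assms by (simp flip: m_assoc)
  then have "inv g \<otimes> k = (inv g \<otimes> h) \<otimes> (inv h \<otimes> k)"
    using assms by (simp add: m_assoc)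
  then show ?thesis
    unfolding word_dist_def using assms len_mult[of "inv g \<otimes> h" "inv h \<otimes> k"] by simp
qed

text \<open>Elements of length at most \<open>n\<close> are values of words of length at most
  \<open>n\<close> over at most \<open>2 * card S\<close> letters, so it suffices to count
  words.\<close>

lemma len_le_ball:
  assumes "finite S"
  shows "finite {g \<in> carrier G. len g \<le> n}"
    and "card {g \<in> carrier G. len g \<le> n} \<le> (2 * card S + 1) ^ n"
proof -
  let ?T = "S \<union> m_inv G ` S"
  let ?W = "{ws. set ws \<subseteq> ?T \<and> length ws \<le> n}"
  have T: "finite ?T" using assms by simp
  have cT: "card ?T \<le> 2 * card S"
    using card_Un_le[of S "m_inv G ` S"] card_image_le[OF assms, of "m_inv G"] by simp
  have sub: "{g \<in> carrier G. len g \<le> n} \<subseteq> (\<lambda>ws. foldr (\<otimes>) ws \<one>) ` ?W"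
  proof
    fix g assume g: "g \<in> {g \<in> carrier G. len g \<le> n}"
    then have "g \<in> carrier G" by simp
    then obtain ws where "set ws \<subseteq> ?T" "foldr (\<otimes>) ws \<one> = g" "length ws = len g"
      by (rule obtain_shortest_word)
    then show "g \<in> (\<lambda>ws. foldr (\<otimes>) ws \<one>) ` ?W"
      using g by (intro image_eqI[of _ _ ws]) auto
  qed
  have fW: "finite ?W" using finite_lists_length_le[OF T] .
  then show "finite {g \<in> carrier G. len g \<le> n}"
    using sub by (meson finite_imageI finite_subset)
  \<comment> \<open>The left side counts the words over \<open>m\<close> letters; padding them with
    a blank letter explains the bound.\<close>
  have "(\<Sum>i\<le>n. m ^ i) \<le> (m + 1) ^ n" for m n :: nat
  proof (induction n)
    case (Suc n)
    have "m * m ^ n \<le> m * (m + 1) ^ n" by (intro mult_left_mono power_mono) auto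
    then have "(\<Sum>i\<le>n. m ^ i) + m * m ^ n \<le> (m + 1) ^ n + m * (m + 1) ^ n"
      using Suc.IH by (rule add_mono[rotated])
    then show ?case by simp
  qed simp
  then have "card ?W \<le> (card ?T + 1) ^ n"
    by (simp add: card_lists_length_le[OF T])
  also have "\<dots> \<le> (2 * card S + 1) ^ n" using cT by (intro power_mono) auto
  finally show "card {g \<in> carrier G. len g \<le> n} \<le> (2 * card S + 1) ^ n"
    using sub fW by (meson card_image_le card_mono finite_imageI le_trans)
qed

text \<open>Left translation by \<open>g\<close> carries the ball around the identity to the ball
  around \<open>g\<close>, and lengths are integers, so the radius may be rounded down.\<close>

lemma wdist_le_ball:
  assumes "finite S" "g \<in> carrier G"
  shows "finite {h \<in> carrier G. wdist g h \<le> r}"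
    and "card {h \<in> carrier G. wdist g h \<le> r} \<le> (2 * card S + 1) ^ nat \<lfloor>r\<rfloor>"
proof -
  let ?B = "{h \<in> carrier G. len h \<le> nat \<lfloor>r\<rfloor>}"
  have sub: "{h \<in> carrier G. wdist g h \<le> r} \<subseteq> (\<otimes>) g ` ?B"
  proof
    fix h assume h: "h \<in> {h \<in> carrier G. wdist g h \<le> r}"
    then have "g \<otimes> (inv g \<otimes> h) = h" using assms by (simp flip: m_assoc)
    moreover have "len (inv g \<otimes> h) \<le> nat \<lfloor>r\<rfloor>"
      using h unfolding word_dist_def by (simp add: le_nat_floor)
    ultimately show "h \<in> (\<otimes>) g ` ?B" using assms h by (intro image_eqI[of _ _ "inv g \<otimes> h"]) auto
  qed
  with len_le_ball[OF assms(1)] show "finite {h \<in> carrier G. wdist g h \<le> r}"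
    by (meson finite_imageI finite_subset)
  show "card {h \<in> carrier G. wdist g h \<le> r} \<le> (2 * card S + 1) ^ nat \<lfloor>r\<rfloor>"
    using sub len_le_ball[OF assms(1), of "nat \<lfloor>r\<rfloor>"]
    by (meson card_image_le card_mono finite_imageI le_trans)
qed

lemma countable_carrier:
  assumes "finite S"
  shows "countable (carrier G)"
proof -
  have "carrier G \<subseteq> (\<Union>n. {g \<in> carrier G. len g \<le> n})" by auto
  moreover have "countable (\<Union>n. {g \<in> carrier G. len g \<le> n})"
    using len_le_ball(1)[OF assms] by (intro countable_UN) (auto intro: countable_finite)
  ultimately show ?thesis using countable_subset by blast
qed

end

section \<open>Greedy colouring and the upper bound\<close>

text \<open>Points are coloured in the order of an injection into the naturals. At most
  \<open>n\<close> neighbours block at most \<open>n\<close> of the \<open>n + 1\<close>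
  colours.\<close>

lemma greedy_colouring:
  fixes adj :: "'a \<Rightarrow> 'a \<Rightarrow> bool"
  assumes "countable X"
    and fin: "\<And>x. x \<in> X \<Longrightarrow> finite {y \<in> X. adj x y}"
    and card: "\<And>x. x \<in> X \<Longrightarrow> card {y \<in> X. adj x y} \<le> n"
    and sym: "\<And>x y. x \<in> X \<Longrightarrow> y \<in> X \<Longrightarrow> adj x y \<Longrightarrow> adj y x"
  shows "\<exists>colour :: 'a \<Rightarrow> nat. colour ` X \<subseteq> {..n} \<and>
    (\<forall>x\<in>X. \<forall>y\<in>X. x \<noteq> y \<and> adj x y \<longrightarrow> colour x \<noteq> colour y)"
proof -
  obtain e :: "'a \<Rightarrow> nat" where e: "inj_on e X" using \<open>countable X\<close> unfolding countable_def by blast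
  \<comment> \<open>\<open>P f x c\<close> says that \<open>c\<close> is a legal colour for
    \<open>x\<close> once the earlier points are coloured by \<open>f\<close>. It looks only at
    earlier points, as well-founded choice demands.\<close>
  define P where "P = (\<lambda>(f :: 'a \<Rightarrow> nat) x c.
    x \<in> X \<longrightarrow> c \<le> n \<and> (\<forall>y\<in>X. e y < e x \<and> adj x y \<longrightarrow> f y \<noteq> c))"
  have "\<exists>f. \<forall>x. P f x (f x)"
  proof (rule dependent_wf_choice[of "inv_image less_than e"])
    show "P f x c = P g x c" if "\<And>z. (z, x) \<in> inv_image less_than e \<Longrightarrow> f z = g z" for f g x c
      using that unfolding P_def by auto
    show "\<exists>c. P f x c" for x f
    proof (cases "x \<in> X")
      case True
      \<comment> \<open>The colours that \<open>f\<close> gives to later neighbours are avoided as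
        well; the degree bound still leaves a free colour.\<close>
      let ?N = "f ` {y \<in> X. adj x y}"
      have "card ?N \<le> n"
        by (rule le_trans[OF card_image_le[OF fin[OF True]] card[OF True]])
      then have "\<not> {..n} \<subseteq> ?N"
        using card_mono[of ?N "{..n}"] fin[OF True] by auto
      then obtain c where "c \<le> n" "c \<notin> ?N" by auto
      then show ?thesis unfolding P_def by (intro exI[of _ c]) auto
    qed (auto simp: P_def)
  qed simp
  then obtain f where f: "\<And>x. P f x (f x)" by blast
  have "f x \<noteq> f y" if "x \<in> X" "y \<in> X" "x \<noteq> y" "adj x y" for x y
  proof -
    \<comment> \<open>Whichever point comes later avoided the colour of the other; symmetry of
      \<open>adj\<close> covers both orders.\<close>
    have "e x \<noteq> e y" using e that by (auto dest: inj_onD)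
    then consider "e x < e y" | "e y < e x" by linarith
    then show ?thesis
      using f[of x] f[of y] that sym unfolding P_def by cases metis+
  qed
  moreover have "f ` X \<subseteq> {..n}" using f unfolding P_def by auto
  ultimately show ?thesis by blast
qed

text \<open>No step of a chain can leave its starting point, so induction along the chain shows that
  it is constant.\<close>

lemma scale_cluster_singleton:
  assumes "scale_cluster d r A" "x \<in> A" "y \<in> A"
    and step: "\<And>u v. u \<in> A \<Longrightarrow> v \<in> A \<Longrightarrow> d u v \<le> r \<Longrightarrow> u = v"
  shows "x = y"
proof -
  obtain zs where "zs \<noteq> []" "hd zs = x" "last zs = y" "set zs \<subseteq> A" "successively (\<lambda>u v. d u v \<le> r) zs"
    using assms unfolding scale_cluster_def scale_connected_def by blast
  then show ?thesis
  proof (induction zs arbitrary: x)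
    case (Cons z zs)
    show ?case
    proof (cases "zs = []")
      case False
      then have "successively (\<lambda>u v. d u v \<le> r) zs" "d z (hd zs) \<le> r" "hd zs \<in> A" "z \<in> A"
        using Cons.prems by (auto simp: successively_Cons)
      moreover from this have "z = hd zs" using step by blast
      ultimately show ?thesis using Cons.IH[of "hd zs"] Cons.prems False by auto
    qed (use Cons.prems in auto)
  qed simp
qed

text \<open>A greedy colouring of the graph joining points at distance at most \<open>r\<close>
  gives distinct points within \<open>r\<close> different colours, so monochromatic clusters have at
  most one point.\<close>

lemma scale_dim_le_colouring:
  assumes "countable X"
    and fin: "\<And>x. x \<in> X \<Longrightarrow> finite {y \<in> X. d x y \<le> r}"
    and card: "\<And>x. x \<in> X \<Longrightarrow> card {y \<in> X. d x y \<le> r} \<le> n"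
    and sym: "\<And>x y. x \<in> X \<Longrightarrow> y \<in> X \<Longrightarrow> d x y = d y x"
    and self: "\<And>x. x \<in> X \<Longrightarrow> d x x = 0"
    and "0 \<le> D"
  shows "scale_dim_le X d r D n"
proof -
  have sym': "d y x \<le> r" if "x \<in> X" "y \<in> X" "d x y \<le> r" for x y
    using sym[OF that(1,2)] that(3) by simp
  have "\<exists>colour :: 'a \<Rightarrow> nat. colour ` X \<subseteq> {..n} \<and>
      (\<forall>x\<in>X. \<forall>y\<in>X. x \<noteq> y \<and> d x y \<le> r \<longrightarrow> colour x \<noteq> colour y)"
    by (rule greedy_colouring[OF assms(1) fin card sym'])
  then obtain colour :: "'a \<Rightarrow> nat" where colour: "colour ` X \<subseteq> {..n}"
    "\<forall>x\<in>X. \<forall>y\<in>X. x \<noteq> y \<and> d x y \<le> r \<longrightarrow> colour x \<noteq> colour y"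
    by (elim exE conjE)
  have "set_diameter d A \<le> ereal D"
    if A: "A \<subseteq> X" "\<forall>x\<in>A. \<forall>y\<in>A. colour x = colour y" "scale_cluster d r A" for A
  proof -
    have eq: "x = y" if "x \<in> A" "y \<in> A" for x y

    proof (rule scale_cluster_singleton[OF A(3) that])
      fix u v assume "u \<in> A" "v \<in> A" "d u v \<le> r"
      then show "u = v" using A(1,2) colour(2) by (meson subsetD)
    qed
    have "d x y \<le> D" if "x \<in> A" "y \<in> A" for x y
      using eq[OF that] self A(1) that \<open>0 \<le> D\<close> by auto
    then show ?thesis unfolding set_diameter_def by (intro SUP_least) simp
  qed
  then show ?thesis
    unfolding scale_dim_le_def
    by (intro exI[of _ colour] conjI allI impI colour(1)) (elim conjE)
qed

lemma scale_dim_upper: "scale_dim_le X d r D n \<Longrightarrow> scale_dim X d r D \<le> enat n"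
  unfolding scale_dim_def by (rule Inf_lower) blast

text \<open>Either no \<open>n\<close> is admissible and the dimension is infinite, or the infimum
  is attained because \<open>enat\<close> is well-ordered.\<close>

lemma scale_dim_lower:
  assumes "\<And>n. scale_dim_le X d r D n \<Longrightarrow> b \<le> real n"
  shows "ereal b \<le> ereal_of_enat (scale_dim X d r D)"
proof (cases "{enat n | n. scale_dim_le X d r D n} = {}")
  case True
  then show ?thesis unfolding scale_dim_def by (simp add: top_enat_def)
next
  case False
  then obtain x where "x \<in> {enat n | n. scale_dim_le X d r D n}" by blast
  then have "(LEAST x. x \<in> {enat n | n. scale_dim_le X d r D n}) \<in> {enat n | n. scale_dim_le X d r D n}"
    by (rule LeastI)
  then have "scale_dim X d r D \<in> {enat n | n. scale_dim_le X d r D n}"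
    unfolding scale_dim_def Inf_enat_def using False by simp
  then show ?thesis using assms by auto
qed

text \<open>Ball sizes bound the number of colours, for any nonnegative control. The rate is the
  logarithm of the base in the ball estimate.\<close>

lemma (in generated_group) controlled_dim_upper:
  assumes "finite S" "0 \<le> D r" "0 < r"
  shows "ereal_of_enat (controlled_dim (carrier G) wdist D r) \<le> ereal (exp (ln (2 * card S + 1) * r))"
proof -
  let ?n = "(2 * card S + 1) ^ nat \<lfloor>r\<rfloor>"
  have "scale_dim_le (carrier G) wdist r (D r) ?n"
    using countable_carrier wdist_le_ball wdist_commute wdist_self assms
    by (intro scale_dim_le_colouring) auto
  then have "controlled_dim (carrier G) wdist D r \<le> enat ?n"
    unfolding controlled_dim_def by (rule scale_dim_upper)
  then have "ereal_of_enat (controlled_dim (carrier G) wdist D r) \<le> ereal (real ?n)"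
    using ereal_of_enat_le_iff by (metis ereal_of_enat_simps(1))
  also have "real ?n = (2 * real (card S) + 1) powr real (nat \<lfloor>r\<rfloor>)"
    by (simp add: powr_realpow add.commute)
  also have "\<dots> \<le> (2 * real (card S) + 1) powr r"
    using \<open>0 < r\<close> by (intro powr_mono) auto
  also have "\<dots> = exp (ln (2 * card S + 1) * r)"
    by (simp add: powr_def mult.commute)
  finally show ?thesis by simp
qed

section \<open>Colourings of the cube\<close>

text \<open>Subsets of an index set encode the vertices of the cube; \<open>flip i\<close> moves
  along the edge in direction \<open>i\<close>.\<close>

definition flip :: "'a \<Rightarrow> 'a set \<Rightarrow> 'a set" where
  "flip i A = sym_diff A {i}"

lemma flip_flip [simp]: "flip i (flip i A) = A"
  unfolding flip_def by auto

lemma flip_subset: "A \<subseteq> I \<Longrightarrow> i \<in> I \<Longrightarrow> flip i A \<subseteq> I"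
  unfolding flip_def by auto

text \<open>\<open>\<rho> y\<close> stands for the base point of the cluster of \<open>y\<close>.
  The hypothesis \<open>same\<close> compares two neighbours of a common vertex \<open>x\<close>,
  which is all that the fibres of the counting map require.\<close>

lemma hypercube_edge_count:
  fixes col :: "'a set \<Rightarrow> nat" and \<rho> :: "'a set \<Rightarrow> 'a set"
  assumes "finite I" and col: "\<And>y. y \<subseteq> I \<Longrightarrow> col y < N"
    and \<rho>: "\<And>y. y \<subseteq> I \<Longrightarrow> \<rho> y \<subseteq> I"
    and diam: "\<And>y. y \<subseteq> I \<Longrightarrow> card (sym_diff y (\<rho> y)) \<le> R"
    and same: "\<And>x i j. x \<subseteq> I \<Longrightarrow> i \<in> I \<Longrightarrow> j \<in> I \<Longrightarrow> col (flip i x) = col (flip j x) \<Longrightarrow>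
      \<rho> (flip i x) = \<rho> (flip j x)"
  shows "card I \<le> R + N * (R + 1)"
proof -
  \<comment> \<open>The pairs of a vertex \<open>y\<close> and a direction in which \<open>y\<close>
    agrees with its base point.\<close>
  define T where "T = (SIGMA y:Pow I. I - sym_diff y (\<rho> y))"
  \<comment> \<open>The fibres of the map sending \<open>(y, i)\<close> to the flipped vertex and
    the colour of \<open>y\<close>.\<close>
  define fib where "fib = (\<lambda>(x, c). {(y, i) \<in> T. flip i y = x \<and> col y = c})"
  have finT: "finite T" unfolding T_def using \<open>finite I\<close> by auto
  have "2 ^ card I * (card I - R) = (\<Sum>y\<in>Pow I. card I - R)"
    using \<open>finite I\<close> by (simp add: card_Pow)
  also have "\<dots> \<le> (\<Sum>y\<in>Pow I. card (I - sym_diff y (\<rho> y)))"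
  proof (rule sum_mono)
    fix y assume "y \<in> Pow I"
    then have "card (sym_diff y (\<rho> y)) \<le> R" "sym_diff y (\<rho> y) \<subseteq> I"
      using diam \<rho> by blast+
    then show "card I - R \<le> card (I - sym_diff y (\<rho> y))"
      using \<open>finite I\<close> by (subst card_Diff_subset) (auto intro: finite_subset)
  qed
  also have "\<dots> = card T"
    unfolding T_def using \<open>finite I\<close> by (subst card_SigmaI) auto
  also have "card T \<le> card (\<Union>z\<in>Pow I \<times> {..<N}. fib z)"
  proof (rule card_mono)
    show "finite (\<Union>z\<in>Pow I \<times> {..<N}. fib z)"
      by (rule finite_subset[OF _ finT]) (auto simp: fib_def)
    show "T \<subseteq> (\<Union>z\<in>Pow I \<times> {..<N}. fib z)"
    proof
      fix e assume "e \<in> T"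
      then obtain y i where e: "e = (y, i)" "y \<subseteq> I" "i \<in> I"
        unfolding T_def by blast
      show "e \<in> (\<Union>z\<in>Pow I \<times> {..<N}. fib z)"
      proof (rule UN_I)
        show "(flip i y, col y) \<in> Pow I \<times> {..<N}" using e col flip_subset by simp
        show "e \<in> fib (flip i y, col y)" using e \<open>e \<in> T\<close> unfolding fib_def by simp
      qed
    qed
  qed
  also have "\<dots> \<le> (\<Sum>z\<in>Pow I \<times> {..<N}. card (fib z))"
    using \<open>finite I\<close> by (intro card_UN_le) auto
  also have "\<dots> \<le> (\<Sum>z\<in>Pow I \<times> {..<N}. R + 1)"
  proof (rule sum_mono)
    fix z assume "z \<in> Pow I \<times> {..<N}"
    obtain x c where z: "z = (x, c)" by force
    show "card (fib z) \<le> R + 1"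
    proof (cases "fib z = {}")
      case False
      then obtain y0 i0 where e0: "(y0, i0) \<in> T" "flip i0 y0 = x" "col y0 = c"
        unfolding fib_def z by auto
      let ?p = "\<rho> y0"
      have y0: "y0 \<subseteq> I" "i0 \<in> I" "y0 = flip i0 x"
        using e0 unfolding T_def by auto
      have xI: "x \<subseteq> I" using flip_subset[OF y0(1,2)] e0(2) by simp
      have y0p: "finite (sym_diff y0 ?p)"
        using finite_subset[OF y0(1) \<open>finite I\<close>] finite_subset[OF \<rho>[OF y0(1)] \<open>finite I\<close>] by simp
      \<comment> \<open>All \<open>y\<close> in the fibre share the base point \<open>?p\<close>.
        Since \<open>y\<close> agrees with \<open>?p\<close> at \<open>i\<close>, the vertex
        \<open>x = flip i y\<close> disagrees there.\<close>
      have "snd ` fib z \<subseteq> sym_diff x ?p"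
      proof
        fix i assume "i \<in> snd ` fib z"
        then obtain y where y: "(y, i) \<in> T" "flip i y = x" "col y = c"
          unfolding fib_def z by auto
        then have yi: "y = flip i x" "i \<in> I" unfolding T_def by auto
        have "\<rho> y = ?p" using same[OF xI yi(2) y0(2)] y(3) y0(3) yi(1) e0(3) by simp
        then have "i \<notin> sym_diff y ?p" using y unfolding T_def by auto
        then show "i \<in> sym_diff x ?p" using y(2) unfolding flip_def by auto
      qed
      \<comment> \<open>\<open>x\<close> and \<open>y0\<close> differ only in direction
        \<open>i0\<close>, which costs the extra 1 in \<open>R + 1\<close>.\<close>
      also have "sym_diff x ?p \<subseteq> insert i0 (sym_diff y0 ?p)"
        using e0(2) unfolding flip_def by auto
      finally have "card (snd ` fib z) \<le> card (insert i0 (sym_diff y0 ?p))"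
        using y0p by (intro card_mono) auto
      also have "\<dots> \<le> R + 1"
        using diam[OF y0(1)] card_insert_le_m1 y0p by (simp add: card_insert_if)
      finally have "card (snd ` fib z) \<le> R + 1" .
      \<comment> \<open>Within a fibre the direction determines the pair, because
        \<open>y = flip i x\<close>.\<close>
      moreover have "inj_on snd (fib z)"
      proof (rule inj_onI)
        fix e e' assume "e \<in> fib z" "e' \<in> fib z" "snd e = snd e'"
        then have "flip (snd e) (fst e) = flip (snd e) (fst e')" unfolding fib_def z by auto
        then have "fst e = fst e'" by (metis flip_flip)
        with \<open>snd e = snd e'\<close> show "e = e'" by (simp add: prod_eq_iff)
      qed
      ultimately show ?thesis by (simp add: card_image)
    qed simp
  qed
  also have "\<dots> = 2 ^ card I * (N * (R + 1))"
    using \<open>finite I\<close> by (simp add: card_Pow card_cartesian_product algebra_simps)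
  finally have "2 ^ card I * (card I - R) \<le> 2 ^ card I * (N * (R + 1))" .
  then have "card I - R \<le> N * (R + 1)" by (subst (asm) mult_le_cancel1) auto
  then show ?thesis by linarith
qed

text \<open>The connected components of same-coloured vertices at distance at most \<open>r\<close>
  map to monochromatic clusters, so they have diameter at most \<open>D\<close> and, by
  \<open>far\<close>, Hamming diameter at most \<open>M * D\<close>. The edge count then applies
  with \<open>n + 1\<close> colours.\<close>

lemma scale_dim_le_hypercube:
  fixes g :: "'i set \<Rightarrow> 'a"
  assumes "finite I" and X: "\<And>A. A \<subseteq> I \<Longrightarrow> g A \<in> X"
    and sym: "\<And>x y. x \<in> X \<Longrightarrow> y \<in> X \<Longrightarrow> d x y = d y x"
    and near: "\<And>A i j. A \<subseteq> I \<Longrightarrow> i \<in> I \<Longrightarrow> j \<in> I \<Longrightarrow> d (g (flip i A)) (g (flip j A)) \<le> r"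
    and far: "\<And>A B. A \<subseteq> I \<Longrightarrow> B \<subseteq> I \<Longrightarrow> real (card (sym_diff A B)) \<le> M * d (g A) (g B)"
    and "0 \<le> M" and dim: "scale_dim_le X d r D n"
  shows "card I \<le> nat \<lfloor>M * D\<rfloor> + (n + 1) * (nat \<lfloor>M * D\<rfloor> + 1)"
proof -
  obtain colour :: "'a \<Rightarrow> nat" where colour: "colour ` X \<subseteq> {..n}"
    and diam: "\<forall>A\<subseteq>X. (\<forall>x\<in>A. \<forall>y\<in>A. colour x = colour y) \<and> scale_cluster d r A \<longrightarrow>
      set_diameter d A \<le> ereal D"
    using dim unfolding scale_dim_le_def by (elim exE conjE)
  define E where "E = {(A, B). A \<subseteq> I \<and> B \<subseteq> I \<and> colour (g A) = colour (g B) \<and> d (g A) (g B) \<le> r}"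
  have "sym E"
  proof (rule symI)
    fix A B assume "(A, B) \<in> E"
    then show "(B, A) \<in> E" using sym[OF X X, of A B] unfolding E_def by simp
  qed
  then have symE: "sym (E\<^sup>*)" by (rule sym_rtrancl)
  \<comment> \<open>One representative per component. The choice depends only on the set of
    reachable vertices, so it is constant on components.\<close>
  define \<rho> where "\<rho> = (\<lambda>A. SOME B. (A, B) \<in> E\<^sup>*)"
  have \<rho>: "(A, \<rho> A) \<in> E\<^sup>*" for A
    unfolding \<rho>_def by (rule someI[of _ A]) simp
  have \<rho>_eq: "\<rho> A = \<rho> B" if "(A, B) \<in> E\<^sup>*" for A B
  proof -
    have "(A, C) \<in> E\<^sup>* \<longleftrightarrow> (B, C) \<in> E\<^sup>*" for C
      using rtrancl_trans[OF that, of C] rtrancl_trans[OF symD[OF symE that], of C] by blast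
    then show ?thesis unfolding \<rho>_def by simp
  qed
  have inv: "B \<subseteq> I \<and> colour (g B) = colour (g A)" if "(A, B) \<in> E\<^sup>*" "A \<subseteq> I" for A B
    using that by (induction rule: rtrancl_induct) (auto simp: E_def)
  have close: "d (g A) (g (\<rho> A)) \<le> D" if A: "A \<subseteq> I" for A
  proof -
    \<comment> \<open>The image of the component of \<open>A\<close>. A path of
      \<open>E\<close>-steps becomes a chain inside \<open>?K\<close> itself, as the cluster
      definition demands.\<close>
    let ?K = "g ` (E\<^sup>* `` {A})"
    have K1: "?K \<subseteq> X"
    proof
      fix x assume "x \<in> ?K"
      then obtain B where "(A, B) \<in> E\<^sup>*" "x = g B" by blast
      then show "x \<in> X" using inv[of A B] A X by blast
    qed
    have "colour x = colour (g A)" if "x \<in> ?K" for x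
    proof -
      from that obtain B where "(A, B) \<in> E\<^sup>*" "x = g B" by blast
      then show ?thesis using inv[of A B] A by blast
    qed
    then have K2: "\<forall>x\<in>?K. \<forall>y\<in>?K. colour x = colour y" by metis
    have K3: "scale_cluster d r ?K"
      unfolding scale_cluster_def
    proof (intro ballI)
      fix x y assume "x \<in> ?K" "y \<in> ?K"
      then obtain B C where BC: "(A, B) \<in> E\<^sup>*" "(A, C) \<in> E\<^sup>*" "x = g B" "y = g C" by auto
      have "(B, C) \<in> E\<^sup>*" by (rule rtrancl_trans[OF symD[OF symE BC(1)] BC(2)])
      then have "scale_connected d r ?K (g B) (g C)"
      proof (induction rule: rtrancl_induct)
        case base
        then show ?case
          unfolding scale_connected_def using BC by (intro exI[of _ "[g B]"]) auto
      next
        case (step C C')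
        then obtain zs where zs: "zs \<noteq> []" "hd zs = g B" "last zs = g C" "set zs \<subseteq> ?K"
          "successively (\<lambda>u v. d u v \<le> r) zs"
          unfolding scale_connected_def by blast
        have "(A, C') \<in> E\<^sup>*"
          by (rule rtrancl_into_rtrancl[OF rtrancl_trans[OF BC(1) step.hyps(1)] step.hyps(2)])
        moreover have "d (g C) (g C') \<le> r" using step.hyps unfolding E_def by simp
        ultimately show ?case
          unfolding scale_connected_def using zs
          by (intro exI[of _ "zs @ [g C']"]) (auto simp: successively_append_iff)
      qed
      then show "scale_connected d r ?K x y" using BC by simp
    qed
    have "set_diameter d ?K \<le> ereal D"
      by (rule diam[THEN spec, THEN mp, OF K1, THEN mp, OF conjI[OF K2 K3]])
    moreover have "ereal (d (g A) (g (\<rho> A))) \<le> set_diameter d ?K"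
      unfolding set_diameter_def using \<rho>[of A]
      by (intro SUP_upper2[of "g A"] SUP_upper2[of "g (\<rho> A)"]) auto
    ultimately have "ereal (d (g A) (g (\<rho> A))) \<le> ereal D" by (rule order_trans[rotated])
    then show ?thesis by simp
  qed
  show ?thesis
  proof (rule hypercube_edge_count[where col = "\<lambda>A. colour (g A)" and \<rho> = \<rho>])
    show "colour (g A) < n + 1" if "A \<subseteq> I" for A
      using colour X[OF that] by (auto simp: less_Suc_eq_le)
    show \<rho>I: "\<rho> A \<subseteq> I" if "A \<subseteq> I" for A using inv[OF \<rho> that] by blast
    show "card (sym_diff A (\<rho> A)) \<le> nat \<lfloor>M * D\<rfloor>" if A: "A \<subseteq> I" for A
    proof (rule le_nat_floor)
      show "real (card (sym_diff A (\<rho> A))) \<le> M * D"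
        using far[OF A \<rho>I[OF A]] mult_left_mono[OF close[OF A] \<open>0 \<le> M\<close>] by linarith
    qed
    \<comment> \<open>By \<open>near\<close>, two equally coloured flips of one vertex are joined by
      a single \<open>E\<close>-step.\<close>
    show "\<rho> (flip i A) = \<rho> (flip j A)"
      if "A \<subseteq> I" "i \<in> I" "j \<in> I" "colour (g (flip i A)) = colour (g (flip j A))" for A i j
      using flip_subset[OF that(1,2)] flip_subset[OF that(1,3)] near[OF that(1-3)] that(4)
      by (intro \<rho>_eq r_into_rtrancl) (simp add: E_def)
  qed fact
qed

section \<open>From the cube inequality to an exponential lower bound\<close>

text \<open>If \<open>D\<close> is about the fourth root of \<open>2 ^ k\<close>, the cube
  inequality forces \<open>n\<close> to be at least of order \<open>D ^ 3\<close>. Settling for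
  \<open>D ^ 2\<close> leaves room for the constants.\<close>

lemma controlled_dim_exponential_lower:
  fixes C M :: real
  assumes "0 < C" "1 \<le> M"
    and cube: "\<And>k r D n. C * real (k + 1) \<le> r \<Longrightarrow> scale_dim_le X d r D n \<Longrightarrow>
      2 ^ k \<le> nat \<lfloor>M * D\<rfloor> + (n + 1) * (nat \<lfloor>M * D\<rfloor> + 1)"
  shows "\<exists>\<alpha>>0. \<exists>\<beta>>0. \<exists>c. \<forall>r>0.
    ereal (exp (\<beta> * r) - c) \<le> ereal_of_enat (controlled_dim X d (\<lambda>t. exp (\<alpha> * t)) r)"
proof -
  \<comment> \<open>Chosen so that \<open>exp (b * r) = 2 powr (r / C)\<close>, which is comparable
    to the largest cube dimension available at scale \<open>r\<close>.\<close>
  define b where "b = ln 2 / C"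
  have "b > 0" unfolding b_def using \<open>0 < C\<close> by simp
  \<comment> \<open>The exponential term handles scales below \<open>C\<close>, where no cube is
    available; the other two come from the cases \<open>E < 8 * M\<close> and
    \<open>8 * M \<le> E\<close> below.\<close>
  define c where "c = 64 * M\<^sup>2 + 2 + exp (b / 2 * C)"
  have key: "exp (b / 2 * r) - c \<le> real n"
    if r: "r > 0" and dim: "scale_dim_le X d r (exp (b / 4 * r)) n" for r n
  proof (cases "r < C")
    case True
    then have "exp (b / 2 * r) \<le> exp (b / 2 * C)" using \<open>b > 0\<close> by simp
    then show ?thesis unfolding c_def using zero_le_power2[of M] of_nat_0_le_iff[of n] by linarith
  next
    case False
    define E where "E = exp (b / 4 * r)"
    \<comment> \<open>The largest \<open>k\<close> with \<open>C * (k + 1) \<le> r\<close>; hence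
      \<open>r / C \<le> k + 2\<close>, which costs a factor 4.\<close>
    define k where "k = nat (\<lfloor>r / C\<rfloor> - 1)"
    have "E \<ge> 1" unfolding E_def using \<open>b > 0\<close> r by simp
    then have ME: "M * E \<ge> 1" using \<open>1 \<le> M\<close> mult_mono[of 1 M 1 E] by simp
    have "1 \<le> r / C" using False \<open>0 < C\<close> by simp
    then have "\<lfloor>r / C\<rfloor> \<ge> 1" by linarith
    then have k: "real (k + 1) \<le> r / C" "r / C \<le> real k + 2" unfolding k_def by linarith+
    have "C * real (k + 1) \<le> r" using k(1) \<open>0 < C\<close> by (simp add: field_simps)
    from cube[OF this dim] have le: "2 ^ k \<le> nat \<lfloor>M * E\<rfloor> + (n + 1) * (nat \<lfloor>M * E\<rfloor> + 1)"
      unfolding E_def .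
    have "E ^ 4 = exp (b * r)" unfolding E_def by (simp flip: exp_of_nat_mult)
    also have "\<dots> = 2 powr (r / C)" unfolding b_def powr_def by simp
    also have "\<dots> \<le> 2 powr (real (k + 2))" using k(2) by (intro powr_mono) auto
    also have "\<dots> = 4 * 2 ^ k" by (subst powr_realpow) (auto simp: power_add)
    finally have E4: "E ^ 4 \<le> 4 * 2 ^ k" .
    have "real (2 ^ k) \<le> real (nat \<lfloor>M * E\<rfloor>) + (n + 1) * (real (nat \<lfloor>M * E\<rfloor>) + 1)"
      using of_nat_mono[OF le] by (simp only: of_nat_add of_nat_mult of_nat_1)
    with E4 have "E ^ 4 \<le> 4 * (real (nat \<lfloor>M * E\<rfloor>) + (n + 1) * (real (nat \<lfloor>M * E\<rfloor>) + 1))" by simp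
    also have "\<dots> \<le> 4 * (M * E + (n + 1) * (M * E + M * E))"
    proof -
      have "real (nat \<lfloor>M * E\<rfloor>) \<le> M * E" using ME by linarith
      then show ?thesis using ME by (intro mult_left_mono add_mono) auto
    qed
    also have "\<dots> = E * (4 * M + 8 * M * (real n + 1))" by (simp add: algebra_simps)
    finally have "E ^ 4 \<le> E * (4 * M + 8 * M * (real n + 1))" .
    then have "E * E ^ 3 \<le> E * (4 * M + 8 * M * (real n + 1))"
      by (simp add: power_numeral_reduce)
    then have E3: "E ^ 3 \<le> 4 * M + 8 * M * (real n + 1)" using \<open>E \<ge> 1\<close> by simp
    have "E\<^sup>2 \<le> real n + 2 + 64 * M\<^sup>2"
    \<comment> \<open>A large \<open>E\<close> sacrifices one factor of its cube to cancel
      \<open>8 * M\<close>; a small one has its square absorbed by the constant.\<close>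
    proof (cases "E \<ge> 8 * M")
      case True
      then have "8 * M * E\<^sup>2 \<le> E * E\<^sup>2" by (intro mult_right_mono) auto
      also have "\<dots> = E ^ 3" by (simp add: power_numeral_reduce)
      also have "\<dots> \<le> 4 * M + 8 * M * (real n + 1)" by (rule E3)
      also have "4 * M + 8 * M * (real n + 1) \<le> 8 * M * (real n + 2)"
        using \<open>1 \<le> M\<close> by (simp add: algebra_simps)
      finally have "E\<^sup>2 \<le> real n + 2" using \<open>1 \<le> M\<close> by simp
      then show ?thesis using zero_le_power2[of M] by linarith
    next
      case False
      then have "E\<^sup>2 \<le> (8 * M)\<^sup>2" using \<open>E \<ge> 1\<close> by (intro power_mono) auto
      then show ?thesis by (simp add: power2_eq_square)
    qed
    moreover have "exp (b / 2 * r) = E\<^sup>2" unfolding E_def by (simp flip: exp_of_nat_mult)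
    moreover have "exp (b / 2 * C) > 0" by simp
    ultimately show ?thesis unfolding c_def by linarith
  qed
  have "ereal (exp (b / 2 * r) - c) \<le> ereal_of_enat (controlled_dim X d (\<lambda>t. exp (b / 4 * t)) r)"
    if "r > 0" for r
    unfolding controlled_dim_def by (rule scale_dim_lower) (rule key[OF that])
  moreover have "b / 4 > 0" "b / 2 > 0" using \<open>b > 0\<close> by simp_all
  ultimately show ?thesis
    by (intro exI[of _ "b / 4"] conjI exI[of _ "b / 2"] exI[of _ c] allI impI) assumption+
qed

section \<open>Bumps with disjoint supports\<close>

lemma affine_off_mono: "affine_off P f \<Longrightarrow> P \<subseteq> Q \<Longrightarrow> affine_off Q f"
  unfolding affine_off_def by blast

text \<open>Surjectivity comes from the intermediate value theorem and the continuous inverse from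
  compactness; 0 and 1 are added to \<open>P\<close> to meet the definition.\<close>

lemma thompson_F_restrictI:
  fixes f :: "real \<Rightarrow> real"
  assumes cont: "continuous_on {0..1} f" and mono: "strict_mono_on {0..1} f"
    and ends: "f 0 = 0" "f 1 = 1"
    and P: "finite P" "P \<subseteq> {0..1} \<inter> dyadic_rationals" "affine_off P f"
  shows "restrict f {0..1} \<in> carrier thompson_F"
proof -
  let ?f = "restrict f {0..1}"
  have mono': "strict_mono_on {0..1} ?f" using mono unfolding strict_mono_on_def by simp
  have "f ` {0..1} = {0..1}"
  proof
    show "f ` {0..1} \<subseteq> {0..1}"
      using strict_mono_on_leD[OF mono, of 0] strict_mono_on_leD[OF mono, of _ 1] ends by auto
    show "{0..1} \<subseteq> f ` {0..1}"
    proof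
      fix y :: real assume "y \<in> {0..1}"
      then have "\<exists>x. 0 \<le> x \<and> x \<le> 1 \<and> f x = y"
        using ends cont by (intro IVT') auto
      then show "y \<in> f ` {0..1}" by auto
    qed
  qed
  then have surj: "?f ` {0..1} = {0..1}" by simp
  have inj: "inj_on ?f {0..1}" using mono' by (rule strict_mono_on_imp_inj_on)
  have "continuous_on {0..1} ?f" using cont by (rule continuous_on_eq) simp
  then obtain g where "homeomorphism {0..1} {0..1} ?f g"
    using homeomorphism_compact[OF compact_Icc _ surj inj] by blast
  moreover have "?f \<in> Bij {0..1}"
    unfolding Bij_def bij_betw_def using inj surj by simp
  moreover have "affine_off P ?f"
    unfolding affine_off_def
  proof (intro ballI impI)
    fix a b :: real assume ab: "a \<in> {0..1}" "b \<in> {0..1}" "a < b \<and> P \<inter> {a<..<b} = {}"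
    then obtain k :: int and c :: real where "\<And>x. x \<in> {a..b} \<Longrightarrow> f x = 2 powi k * x + c"
      using affine_offD[OF P(3) ab(1,2)] by metis
    then show "\<exists>(k::int) c. \<forall>x\<in>{a..b}. ?f x = 2 powi k * x + c"
      using ab by (intro exI[of _ k] exI[of _ c]) auto
  qed
  then have "dyadic_piecewise_linear ?f"
    unfolding dyadic_piecewise_linear_iff
    using P affine_off_mono[of P ?f "P \<union> {0, 1}"] by (intro exI[of _ "P \<union> {0, 1}"]) auto
  ultimately show ?thesis unfolding thompson_F_carrier using mono' by blast
qed

text \<open>The first two maps halve $[1/4, 3/4]$ onto $[1/4, 1/2]$ and $[1/2, 3/4]$; their breakpoints are
  $1/4$ and $3/4$. The third is supported on $[5/16, 11/16]$ and has slopes $1/2$ and $2$ there, with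
  break at $9/16$.\<close>

definition thompson_left :: "real \<Rightarrow> real" where
  "thompson_left = (\<lambda>x\<in>{0..1}. max (2 * x - 1) (min x (x / 2 + 1 / 8)))"

definition thompson_right :: "real \<Rightarrow> real" where
  "thompson_right = (\<lambda>x\<in>{0..1}. min (2 * x) (max x (x / 2 + 3 / 8)))"

definition thompson_bump :: "real \<Rightarrow> real" where
  "thompson_bump = (\<lambda>x\<in>{0..1}. min x (max (x / 2 + 5 / 32) (2 * x - 11 / 16)))"

text \<open>The max-min form makes continuity immediate. The three pieces are \<open>x\<close>,
  \<open>x / 2 + 1 / 8\<close> and \<open>2 * x - 1\<close>.\<close>

lemma thompson_left_carrier: "thompson_left \<in> carrier thompson_F"
  unfolding thompson_left_def
proof (rule thompson_F_restrictI)
  let ?f = "\<lambda>x::real. max (2 * x - 1) (min x (x / 2 + 1 / 8))"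
  show "continuous_on {0..1} ?f" by (intro continuous_intros) auto
  show "strict_mono_on {0..1} ?f" by (auto simp: strict_mono_on_def max_def min_def)
  show "{1 / 4, 3 / 4} \<subseteq> {0..1} \<inter> dyadic_rationals"
    using dyadic_rationalsI[of 1 2] dyadic_rationalsI[of 3 2] by simp
  show "affine_off {1 / 4, 3 / 4} ?f"
    unfolding affine_off_def
  proof (intro ballI impI)
    fix a b :: real assume "a < b \<and> {1 / 4, 3 / 4} \<inter> {a<..<b} = {}"
    then have "b \<le> 1 / 4 \<or> 1 / 4 \<le> a \<and> b \<le> 3 / 4 \<or> 3 / 4 \<le> a" by auto
    then consider "b \<le> 1 / 4" | "1 / 4 \<le> a" "b \<le> 3 / 4" | "3 / 4 \<le> a" by blast
    then show "\<exists>(k::int) c. \<forall>x\<in>{a..b}. ?f x = 2 powi k * x + c"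
    proof cases
      case 1
      then show ?thesis by (intro exI[of _ 0] exI[of _ 0]) auto
    next
      case 2
      then show ?thesis by (intro exI[of _ "-1"] exI[of _ "1 / 8"]) auto
    next
      case 3
      then show ?thesis by (intro exI[of _ 1] exI[of _ "- 1"]) auto
    qed
  qed
qed auto

lemma thompson_right_carrier: "thompson_right \<in> carrier thompson_F"
  unfolding thompson_right_def
proof (rule thompson_F_restrictI)
  let ?f = "\<lambda>x::real. min (2 * x) (max x (x / 2 + 3 / 8))"
  show "continuous_on {0..1} ?f" by (intro continuous_intros) auto
  show "strict_mono_on {0..1} ?f" by (auto simp: strict_mono_on_def max_def min_def)
  show "{1 / 4, 3 / 4} \<subseteq> {0..1} \<inter> dyadic_rationals"
    using dyadic_rationalsI[of 1 2] dyadic_rationalsI[of 3 2] by simp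
  show "affine_off {1 / 4, 3 / 4} ?f"
    unfolding affine_off_def
  proof (intro ballI impI)
    fix a b :: real assume "a < b \<and> {1 / 4, 3 / 4} \<inter> {a<..<b} = {}"
    then have "b \<le> 1 / 4 \<or> 1 / 4 \<le> a \<and> b \<le> 3 / 4 \<or> 3 / 4 \<le> a" by auto
    then consider "b \<le> 1 / 4" | "1 / 4 \<le> a" "b \<le> 3 / 4" | "3 / 4 \<le> a" by blast
    then show "\<exists>(k::int) c. \<forall>x\<in>{a..b}. ?f x = 2 powi k * x + c"
    proof cases
      case 1
      then show ?thesis by (intro exI[of _ 1] exI[of _ 0]) auto
    next
      case 2
      then show ?thesis by (intro exI[of _ "-1"] exI[of _ "3 / 8"]) auto
    next
      case 3
      then show ?thesis by (intro exI[of _ 0] exI[of _ 0]) auto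
    qed
  qed
qed auto

lemma thompson_bump_carrier: "thompson_bump \<in> carrier thompson_F"
  unfolding thompson_bump_def
proof (rule thompson_F_restrictI)
  let ?f = "\<lambda>x::real. min x (max (x / 2 + 5 / 32) (2 * x - 11 / 16))"
  show "continuous_on {0..1} ?f" by (intro continuous_intros) auto
  show "strict_mono_on {0..1} ?f" by (auto simp: strict_mono_on_def max_def min_def)
  show "{5 / 16, 9 / 16, 11 / 16} \<subseteq> {0..1} \<inter> dyadic_rationals"
    using dyadic_rationalsI[of 5 4] dyadic_rationalsI[of 9 4] dyadic_rationalsI[of 11 4] by simp
  show "affine_off {5 / 16, 9 / 16, 11 / 16} ?f"
    unfolding affine_off_def
  proof (intro ballI impI)
    fix a b :: real assume "a < b \<and> {5 / 16, 9 / 16, 11 / 16} \<inter> {a<..<b} = {}"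
    then have "b \<le> 5 / 16 \<or> 5 / 16 \<le> a \<and> b \<le> 9 / 16 \<or> 9 / 16 \<le> a \<and> b \<le> 11 / 16 \<or> 11 / 16 \<le> a"
      by auto
    then consider "b \<le> 5 / 16 \<or> 11 / 16 \<le> a" | "5 / 16 \<le> a" "b \<le> 9 / 16"
      | "9 / 16 \<le> a" "b \<le> 11 / 16" by blast
    then show "\<exists>(k::int) c. \<forall>x\<in>{a..b}. ?f x = 2 powi k * x + c"
    proof cases
      case 1
      then show ?thesis by (intro exI[of _ 0] exI[of _ 0]) auto
    next
      case 2
      then show ?thesis by (intro exI[of _ "-1"] exI[of _ "5 / 32"]) auto
    next
      case 3
      then show ?thesis by (intro exI[of _ 1] exI[of _ "- (11 / 16)"]) auto
    qed
  qed
qed auto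

section \<open>Fixed points, products of bumps and breakpoints\<close>

lemma thompson_F_unit:
  assumes "f \<in> carrier thompson_F" "x \<in> {0..1}"
  shows "f x \<in> {0..1}"
  using thompson_F_image[OF assms(1)] assms(2) by blast

lemma thompson_F_inj:
  assumes "f \<in> carrier thompson_F" "x \<in> {0..1}" "y \<in> {0..1}" "f x = f y"
  shows "x = y"
  using inj_onD[OF strict_mono_on_imp_inj_on[OF thompson_F_strict_mono[OF assms(1)]]] assms(2-4)
  by blast

lemma thompson_F_mult_apply:
  assumes "f \<in> carrier thompson_F" "g \<in> carrier thompson_F" "x \<in> {0..1}"
  shows "(f \<otimes>\<^bsub>thompson_F\<^esub> g) x = f (g x)"
  using thompson_F_mult[OF assms(1,2)] assms(3) by (simp add: compose_eq)

text \<open>Subtracting the two fixed point equations gives slope 1, hence translation 0. So a moved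
  point between two fixed points betrays a point of \<open>P\<close>.\<close>

lemma affine_off_fixed_points:
  assumes "affine_off P f" "p \<in> {0..1}" "q \<in> {0..1}" "p < m" "m < q" "P \<inter> {p<..<q} = {}"
    and fp: "f p = p" "f q = q"
  shows "f m = m"
proof -
  obtain k :: int and c :: real where k: "\<And>x. x \<in> {p..q} \<Longrightarrow> f x = 2 powi k * x + c"
    using affine_offD[OF assms(1-3) _ assms(6)] assms(4,5) by (metis less_trans)
  have eqs: "p = 2 powi k * p + c" "q = 2 powi k * q + c" "f m = 2 powi k * m + c"
    using k[of p] k[of q] k[of m] fp assms(4,5) by auto
  then have "(2 powi k - 1) * (q - p) = 0" by (simp add: algebra_simps)
  then have "(2::real) powi k = 1" using assms(4,5) by auto
  with eqs show ?thesis by simp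
qed

text \<open>\<open>J i\<close> is a region that carries the support of \<open>g i\<close>. The
  pattern fixed, moved, fixed in \<open>g_bump\<close> is what later detects breakpoints.\<close>

locale disjoint_bumps =
  fixes I :: "'i set" and J :: "'i \<Rightarrow> real set" and g :: "'i \<Rightarrow> real \<Rightarrow> real"
  assumes fin: "finite I"
    and g_carrier: "i \<in> I \<Longrightarrow> g i \<in> carrier thompson_F"
    and J_sub: "i \<in> I \<Longrightarrow> J i \<subseteq> {0..1}"
    and J_disj: "i \<in> I \<Longrightarrow> j \<in> I \<Longrightarrow> i \<noteq> j \<Longrightarrow> J i \<inter> J j = {}"
    and g_J: "i \<in> I \<Longrightarrow> y \<in> J i \<Longrightarrow> g i y \<in> J i"
    and g_out: "i \<in> I \<Longrightarrow> y \<in> {0..1} \<Longrightarrow> y \<notin> J i \<Longrightarrow> g i y = y"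
    and g_bump: "i \<in> I \<Longrightarrow> \<exists>p m q. p < m \<and> m < q \<and> {p..q} \<subseteq> J i \<and> g i p = p \<and> g i q = q \<and> g i m \<noteq> m"
begin

interpretation F: group thompson_F by (rule group_thompson_F)

text \<open>The cube vertex \<open>A\<close>: the product of the \<open>g i\<close> over
  \<open>i\<close> in \<open>A\<close>. Disjointly supported maps commute, so gluing them pointwise
  avoids choosing an order.\<close>

definition bump_product :: "'i set \<Rightarrow> real \<Rightarrow> real" where
  "bump_product A = (\<lambda>y\<in>{0..1}. if \<exists>i\<in>A. y \<in> J i then g (THE i. i \<in> A \<and> y \<in> J i) y else y)"

lemma bump_product_in:
  assumes "A \<subseteq> I" "i \<in> A" "y \<in> J i"
  shows "bump_product A y = g i y"
proof -
  have "(THE i. i \<in> A \<and> y \<in> J i) = i"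
  proof (rule the_equality)
    show "j = i" if "j \<in> A \<and> y \<in> J j" for j
      using J_disj[of j i] that assms by blast
  qed (use assms in simp)
  moreover have "y \<in> {0..1}" using J_sub assms by blast
  ultimately show ?thesis using assms unfolding bump_product_def by auto
qed

lemma bump_product_out:
  assumes "y \<in> {0..1}" "\<And>i. i \<in> A \<Longrightarrow> y \<notin> J i"
  shows "bump_product A y = y"
  using assms unfolding bump_product_def by auto

lemma bump_product_other:
  assumes "A \<subseteq> I" "i \<in> I" "i \<notin> A" "y \<in> J i"
  shows "bump_product A y = y"
proof (rule bump_product_out)
  show "y \<in> {0..1}" using J_sub assms by blast
  show "y \<notin> J j" if "j \<in> A" for j using J_disj[of i j] that assms by blast
qed

text \<open>\<open>g i\<close> preserves \<open>J i\<close>, where the product over \<open>A\<close>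
  is the identity, and is itself the identity elsewhere. Thus the glued map is a genuine group
  product.\<close>

lemma bump_product_insert:
  assumes A: "A \<subseteq> I" "i \<in> I" "i \<notin> A"
  shows "bump_product (insert i A) = compose {0..1} (bump_product A) (g i)"
proof (rule extensionalityI)
  show "bump_product (insert i A) \<in> extensional {0..1}" unfolding bump_product_def by simp
  show "compose {0..1} (bump_product A) (g i) \<in> extensional {0..1}" by simp
next
  fix y :: real assume y: "y \<in> {0..1}"
  have iA: "insert i A \<subseteq> I" using A by simp
  show "bump_product (insert i A) y = compose {0..1} (bump_product A) (g i) y"
  proof (cases "y \<in> J i")
    case True
    then have "bump_product (insert i A) y = g i y" using bump_product_in[OF iA] by simp
    moreover have "bump_product A (g i y) = g i y"
      using bump_product_other[OF A] g_J[OF A(2) True] by simp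
    ultimately show ?thesis using y by (simp add: compose_eq)
  next
    case False
    then have gi: "g i y = y" using g_out[OF A(2) y] by simp
    show ?thesis
    proof (cases "\<exists>j\<in>A. y \<in> J j")
      case True
      then obtain j where "j \<in> A" "y \<in> J j" by blast
      then have "bump_product (insert i A) y = g j y" "bump_product A y = g j y"
        using bump_product_in[OF iA] bump_product_in[OF A(1)] by simp_all
      then show ?thesis using gi y by (simp add: compose_eq)
    next
      case no: False
      then have "bump_product A y = y" "bump_product (insert i A) y = y"
        using False y by (auto intro: bump_product_out)
      then show ?thesis using gi y by (simp add: compose_eq)
    qed
  qed
qed

lemma bump_product_carrier:
  assumes "A \<subseteq> I"
  shows "bump_product A \<in> carrier thompson_F"
  using finite_subset[OF assms fin] assms
proof (induction A rule: finite_induct)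
  case empty
  have "bump_product {} = \<one>\<^bsub>thompson_F\<^esub>" unfolding bump_product_def thompson_F_one by simp
  then show ?case by simp
next
  case (insert i A)
  then have "bump_product A \<in> carrier thompson_F" "g i \<in> carrier thompson_F"
    using g_carrier by simp_all
  then have "compose {0..1} (bump_product A) (g i) \<in> carrier thompson_F"
    using F.m_closed[of "bump_product A" "g i"] by (simp add: thompson_F_mult)
  then show ?case using bump_product_insert[of A i] insert by simp
qed

lemma bump_product_insert_mult:
  assumes "A \<subseteq> I" "i \<in> I" "i \<notin> A"
  shows "bump_product (insert i A) = bump_product A \<otimes>\<^bsub>thompson_F\<^esub> g i"
  using bump_product_insert[OF assms] thompson_F_mult[OF bump_product_carrier g_carrier] assms
  by simp

text \<open>A bump in which the two products differ contains a breakpoint of the quotient, since an affine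
  map fixing two points is the identity between them.\<close>

lemma card_sym_diff_le:
  assumes A: "A \<subseteq> I" and B: "B \<subseteq> I" and f: "f \<in> carrier thompson_F"
    and eq: "bump_product A \<otimes>\<^bsub>thompson_F\<^esub> f = bump_product B"
    and P: "finite P" "affine_off P f"
  shows "card (sym_diff A B) \<le> card P"
proof -
  have eqx: "bump_product A (f x) = bump_product B x" if "x \<in> {0..1}" for x
    using thompson_F_mult_apply[OF bump_product_carrier[OF A] f that] eq by simp
  have ex: "\<exists>x. x \<in> P \<inter> J i" if i: "i \<in> sym_diff A B" for i
  proof (rule ccontr)
    assume none: "\<nexists>x. x \<in> P \<inter> J i"
    have iI: "i \<in> I" using i A B by blast
    obtain p m q where pmq: "p < m" "m < q" "{p..q} \<subseteq> J i" "g i p = p" "g i q = q" "g i m \<noteq> m"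
      using g_bump[OF iI] by blast
    then have J: "p \<in> J i" "m \<in> J i" "q \<in> J i" by auto
    then have unit: "p \<in> {0..1}" "m \<in> {0..1}" "q \<in> {0..1}" using J_sub[OF iI] by blast+
    \<comment> \<open>On \<open>J i\<close> every product acts as \<open>g i\<close> or as the
      identity, so fixed points of \<open>g i\<close> there are fixed by both products, and hence by
      the quotient \<open>f\<close>.\<close>
    have fixed: "bump_product C x = x" if "C \<subseteq> I" "x \<in> J i" "g i x = x" for C x
      using bump_product_in[OF that(1) _ that(2)] bump_product_other[OF that(1) iI _ that(2)] that(3)
      by (cases "i \<in> C") auto
    have ffix: "f x = x" if "x \<in> J i" "x \<in> {0..1}" "g i x = x" for x
    proof (rule thompson_F_inj[OF bump_product_carrier[OF A] thompson_F_unit[OF f that(2)] that(2)])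
      show "bump_product A (f x) = bump_product A x"
        using eqx[OF that(2)] fixed[OF A that(1,3)] fixed[OF B that(1,3)] by simp
    qed
    have "P \<inter> {p<..<q} = {}" using none pmq(3) by fastforce
    then have "f m = m"
      using affine_off_fixed_points[OF P(2) unit(1,3) pmq(1,2)] ffix J unit pmq by blast
    \<comment> \<open>This is absurd: \<open>i\<close> lies in exactly one of \<open>A\<close> and
      \<open>B\<close>, so exactly one of the two products moves \<open>m\<close>.\<close>
    then have m: "bump_product A m = bump_product B m" using eqx[OF unit(2)] by simp
    show False
    proof (cases "i \<in> A")
      case True
      then have "i \<notin> B" using i by blast
      then show False
        using m bump_product_in[OF A True J(2)] bump_product_other[OF B iI _ J(2)] pmq(6) by simp
    next
      case False
      then have "i \<in> B" using i by blast
      then show False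
        using m bump_product_in[OF B _ J(2)] bump_product_other[OF A iI False J(2)] pmq(6) by simp
    qed
  qed
  \<comment> \<open>One point of \<open>P\<close> per differing coordinate; disjointness of the
    \<open>J i\<close> makes the choice injective.\<close>
  define pt where "pt = (\<lambda>i. SOME x. x \<in> P \<inter> J i)"
  have pt: "pt i \<in> P \<inter> J i" if "i \<in> sym_diff A B" for i
    unfolding pt_def using ex[OF that] by (rule someI_ex)
  have "inj_on pt (sym_diff A B)"
  proof (rule inj_onI, rule ccontr)
    fix i j assume ij: "i \<in> sym_diff A B" "j \<in> sym_diff A B" "pt i = pt j" "i \<noteq> j"
    then have "i \<in> I" "j \<in> I" using A B by blast+
    then show False using J_disj[OF _ _ ij(4)] pt[OF ij(1)] pt[OF ij(2)] ij(3) by auto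
  qed
  moreover have "pt ` sym_diff A B \<subseteq> P" using pt by blast
  ultimately show ?thesis using P(1) by (rule card_inj_on_le)
qed

end

text \<open>Each letter adds at most its own breakpoints, pulled back along the injective rest of
  the word. Hence many breakpoints force a long word.\<close>

lemma thompson_F_breakpoints_le_word:
  assumes "finite T" "T \<subseteq> carrier thompson_F"
  shows "\<exists>M. \<forall>ws. set ws \<subseteq> T \<longrightarrow>
    (\<exists>P. finite P \<and> card P \<le> M * length ws \<and> affine_off P (foldr (mult thompson_F) ws \<one>\<^bsub>thompson_F\<^esub>))"
proof -
  interpret F: group thompson_F by (rule group_thompson_F)
  have "\<exists>P. finite P \<and> affine_off P f" if "f \<in> T" for f
    using assms(2) that unfolding thompson_F_carrier dyadic_piecewise_linear_iff
    by (metis (no_types, lifting) subsetD thompson_F_carrier dyadic_piecewise_linear_iff)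
  then obtain Q where Q: "\<And>f. f \<in> T \<Longrightarrow> finite (Q f) \<and> affine_off (Q f) f" by metis
  \<comment> \<open>The sum over the finite alphabet serves as a common bound for all
    letters.\<close>
  define M where "M = (\<Sum>f\<in>T. card (Q f))"
  have QM: "card (Q f) \<le> M" if "f \<in> T" for f
    unfolding M_def using assms(1) that by (intro member_le_sum) auto
  have "\<exists>P. finite P \<and> card P \<le> M * length ws \<and> affine_off P (foldr (mult thompson_F) ws \<one>\<^bsub>thompson_F\<^esub>)"
    if "set ws \<subseteq> T" for ws
    using that
  proof (induction ws)
    case Nil
    have "affine_off {} \<one>\<^bsub>thompson_F\<^esub>"
      unfolding affine_off_def thompson_F_one by (auto intro!: exI[of _ 0])
    then show ?case by (intro exI[of _ "{}"]) simp
  next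
    case (Cons f ws)
    let ?w = "foldr (mult thompson_F) ws \<one>\<^bsub>thompson_F\<^esub>"
    obtain P where P: "finite P" "card P \<le> M * length ws" "affine_off P ?w"
      using Cons by auto
    have f: "f \<in> T" "f \<in> carrier thompson_F" using Cons.prems assms(2) by auto
    have w: "?w \<in> carrier thompson_F"
      using Cons.prems assms(2) by (intro F.foldr_mult_closed) auto
    let ?R = "P \<union> (?w -` Q f \<inter> {0..1})"
    have inj: "inj_on ?w {0..1}"
      using thompson_F_strict_mono[OF w] by (rule strict_mono_on_imp_inj_on)
    have "affine_off ?R (f \<otimes>\<^bsub>thompson_F\<^esub> ?w)"
      unfolding thompson_F_mult[OF f(2) w]
      using Q[OF f(1)] P(3) thompson_F_strict_mono[OF w] thompson_F_image[OF w]
      by (intro affine_off_compose) auto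
    moreover have "finite ?R"
      using P(1) Q[OF f(1)] inj by (auto intro: finite_vimage_IntI)
    moreover have "card ?R \<le> M * length (f # ws)"
    proof -
      have "card ?R \<le> card P + card (?w -` Q f \<inter> {0..1})" by (rule card_Un_le)
      also have "card (?w -` Q f \<inter> {0..1}) \<le> card (Q f)"
        using inj Q[OF f(1)] by (intro card_vimage_inj_on_le) auto
      finally show ?thesis using P(2) QM[OF f(1)] by simp
    qed
    ultimately show ?case by (intro exI[of _ ?R]) simp
  qed
  then show ?thesis by blast
qed

section \<open>Exponentially many short bumps\<close>

definition thompson_branch :: "bool \<Rightarrow> real \<Rightarrow> real" where
  "thompson_branch b = (if b then thompson_left else thompson_right)"

text \<open>The list is an address in the binary tree of halvings; its first letter is the outermost
  map, the one applied last.\<close>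

definition branch_word :: "bool list \<Rightarrow> real \<Rightarrow> real" where
  "branch_word w = foldr (mult thompson_F) (map thompson_branch w) \<one>\<^bsub>thompson_F\<^esub>"

definition branch_interval :: "bool list \<Rightarrow> real set" where
  "branch_interval w = branch_word w ` {1 / 4<..<3 / 4}"

definition branch_bump :: "bool list \<Rightarrow> real \<Rightarrow> real" where
  "branch_bump w = branch_word w \<otimes>\<^bsub>thompson_F\<^esub> thompson_bump
     \<otimes>\<^bsub>thompson_F\<^esub> inv\<^bsub>thompson_F\<^esub> (branch_word w)"

lemma thompson_branch_carrier: "thompson_branch b \<in> carrier thompson_F"
  unfolding thompson_branch_def using thompson_left_carrier thompson_right_carrier by simp

lemma thompson_branch_apply:
  assumes "x \<in> {1 / 4<..<3 / 4}"
  shows "thompson_branch b x = x / 2 + (if b then 1 / 8 else 3 / 8)"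
  using assms unfolding thompson_branch_def thompson_left_def thompson_right_def by auto

lemma branch_word_carrier: "branch_word w \<in> carrier thompson_F"
  unfolding branch_word_def
  by (rule group.foldr_mult_closed[OF group_thompson_F]) (auto simp: thompson_branch_carrier)

lemma branch_word_Nil: "x \<in> {0..1} \<Longrightarrow> branch_word [] x = x"
  unfolding branch_word_def by (simp add: thompson_F_one)

lemma branch_word_Cons:
  "x \<in> {0..1} \<Longrightarrow> branch_word (b # w) x = thompson_branch b (branch_word w x)"
  using thompson_F_mult_apply[OF thompson_branch_carrier branch_word_carrier, of x b w]
  unfolding branch_word_def by simp

lemma branch_interval_Cons: "branch_interval (b # w) = thompson_branch b ` branch_interval w"
  unfolding branch_interval_def image_image
  by (intro image_cong) (auto simp: branch_word_Cons)

lemma branch_interval_subset: "branch_interval w \<subseteq> {1 / 4<..<3 / 4}"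
proof (induction w)
  case Nil
  then show ?case unfolding branch_interval_def by (auto simp: branch_word_Nil)
next
  case (Cons b w)
  show ?case
  proof
    fix y assume "y \<in> branch_interval (b # w)"
    then obtain x where "x \<in> {1 / 4<..<3 / 4}" "y = thompson_branch b x"
      using Cons unfolding branch_interval_Cons by blast
    then show "y \<in> {1 / 4<..<3 / 4}" using thompson_branch_apply[of x b] by (auto split: if_splits)
  qed
qed

text \<open>Different first letters lead to different halves, which are disjoint as open intervals;
  equal first letters cancel by injectivity and the induction continues.\<close>

lemma branch_interval_disjoint:
  assumes "length w = length w'" "w \<noteq> w'"
  shows "branch_interval w \<inter> branch_interval w' = {}"
  using assms
proof (induction w w' rule: list_induct2)
  case (Cons b w b' w')
  show ?case
  proof (rule ccontr)
    assume "branch_interval (b # w) \<inter> branch_interval (b' # w') \<noteq> {}"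
    then obtain x x' where x: "x \<in> branch_interval w" "x' \<in> branch_interval w'"
      "thompson_branch b x = thompson_branch b' x'"
      unfolding branch_interval_Cons by blast
    then have range: "x \<in> {1 / 4<..<3 / 4}" "x' \<in> {1 / 4<..<3 / 4}"
      using branch_interval_subset by blast+
    then have eq: "x / 2 + (if b then 1 / 8 else 3 / 8) = x' / 2 + (if b' then 1 / 8 else 3 / 8)"
      using x(3) by (simp only: thompson_branch_apply)
    then have "b = b'" using range by (auto split: if_splits)
    with eq have "x = x'" by simp
    then show False using x Cons \<open>b = b'\<close> by auto
  qed
qed simp

lemma branch_bump_carrier: "branch_bump w \<in> carrier thompson_F"
proof -
  interpret F: group thompson_F by (rule group_thompson_F)
  show ?thesis
    unfolding branch_bump_def using branch_word_carrier thompson_bump_carrier by simp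
qed

text \<open>In the coordinate given by \<open>branch_word w\<close>, the conjugate acts as
  \<open>thompson_bump\<close>. All properties of the bumps are transported through this
  identity.\<close>

lemma branch_bump_apply:
  assumes "x \<in> {0..1}"
  shows "branch_bump w (branch_word w x) = branch_word w (thompson_bump x)"
proof -
  interpret F: group thompson_F by (rule group_thompson_F)
  have "branch_bump w \<otimes>\<^bsub>thompson_F\<^esub> branch_word w = branch_word w \<otimes>\<^bsub>thompson_F\<^esub> thompson_bump"
    unfolding branch_bump_def
    using branch_word_carrier[of w] thompson_bump_carrier by (simp add: F.m_assoc)
  then show ?thesis
    using thompson_F_mult_apply[OF branch_bump_carrier branch_word_carrier assms, of w w]
      thompson_F_mult_apply[OF branch_word_carrier thompson_bump_carrier assms, of w] by simp
qed

lemma disjoint_bumps_branch: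
  "disjoint_bumps {w. length w = k} branch_interval branch_bump"
proof
  show "finite {w :: bool list. length w = k}"
    using finite_lists_length_eq[of "UNIV :: bool set" k] by simp
next
  fix w :: "bool list" assume "w \<in> {w. length w = k}"
  show "branch_bump w \<in> carrier thompson_F" by (rule branch_bump_carrier)
  show "branch_interval w \<subseteq> {0..1}" using branch_interval_subset[of w] by auto
  have bump_range: "thompson_bump x \<in> {1 / 4<..<3 / 4}" if "x \<in> {1 / 4<..<3 / 4}" for x
    using that unfolding thompson_bump_def by (auto simp: max_def min_def)
  show "branch_bump w y \<in> branch_interval w" if "y \<in> branch_interval w" for y
  proof -
    obtain x where x: "x \<in> {1 / 4<..<3 / 4}" "y = branch_word w x"
      using \<open>y \<in> branch_interval w\<close> unfolding branch_interval_def by blast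
    then have "branch_bump w y = branch_word w (thompson_bump x)" by (simp add: branch_bump_apply)
    then show ?thesis using bump_range[OF x(1)] unfolding branch_interval_def by blast
  qed
  show "branch_bump w y = y" if y: "y \<in> {0..1}" "y \<notin> branch_interval w" for y
  proof -
    have "y \<in> branch_word w ` {0..1}" using thompson_F_image[OF branch_word_carrier] y(1) by simp
    then obtain x where x: "x \<in> {0..1}" "y = branch_word w x" by blast
    then have "x \<notin> {1 / 4<..<3 / 4}" using y(2) unfolding branch_interval_def by blast
    then have "thompson_bump x = x" using x(1) unfolding thompson_bump_def by auto
    then show ?thesis using branch_bump_apply[OF x(1)] x(2) by simp
  qed
  show "\<exists>p m q. p < m \<and> m < q \<and> {p..q} \<subseteq> branch_interval w \<and> branch_bump w p = p \<and>
    branch_bump w q = q \<and> branch_bump w m \<noteq> m"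
  proof -
    \<comment> \<open>\<open>p\<close>, \<open>m\<close>, \<open>q\<close> are the images of 5/16,
      9/16 and 11/16: the original bump fixes the outer two and sends 9/16 to 7/16.\<close>
    let ?\<phi> = "branch_word w"
    note mono = thompson_F_strict_mono[OF branch_word_carrier[of w]]
    have lt: "?\<phi> (5 / 16) < ?\<phi> (9 / 16)" "?\<phi> (9 / 16) < ?\<phi> (11 / 16)"
      using mono by (simp_all add: strict_mono_on_def)
    have "{?\<phi> (5 / 16)..?\<phi> (11 / 16)} \<subseteq> branch_interval w"
    proof
      fix y assume y: "y \<in> {?\<phi> (5 / 16)..?\<phi> (11 / 16)}"
      have "?\<phi> (5 / 16) \<in> {0..1}" "?\<phi> (11 / 16) \<in> {0..1}"
        by (rule thompson_F_unit[OF branch_word_carrier]; simp)+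
      then have "y \<in> ?\<phi> ` {0..1}" using y thompson_F_image[OF branch_word_carrier] by auto
      then obtain x where x: "x \<in> {0..1}" "y = ?\<phi> x" by blast
      have "5 / 16 \<le> x" "x \<le> 11 / 16"
        using y x strict_mono_on_less_eq[OF mono, of "5 / 16" x]
          strict_mono_on_less_eq[OF mono, of x "11 / 16"] by auto
      then have "x \<in> {1 / 4<..<3 / 4}" by simp
      then show "y \<in> branch_interval w" using x(2) unfolding branch_interval_def by blast
    qed
    moreover have b: "thompson_bump (5 / 16) = 5 / 16" "thompson_bump (11 / 16) = 11 / 16"
      "thompson_bump (9 / 16) = 7 / 16"
      unfolding thompson_bump_def by auto
    have "branch_bump w (?\<phi> (5 / 16)) = ?\<phi> (5 / 16)" "branch_bump w (?\<phi> (11 / 16)) = ?\<phi> (11 / 16)"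
      "branch_bump w (?\<phi> (9 / 16)) = ?\<phi> (7 / 16)"
      using branch_bump_apply[of "5 / 16" w] branch_bump_apply[of "11 / 16" w]
        branch_bump_apply[of "9 / 16" w] unfolding b by simp_all
    moreover have "?\<phi> (7 / 16) < ?\<phi> (9 / 16)" using mono by (simp add: strict_mono_on_def)
    ultimately show ?thesis
      using lt by (intro exI[of _ "?\<phi> (5 / 16)"] exI[of _ "?\<phi> (9 / 16)"] exI[of _ "?\<phi> (11 / 16)"]) simp
  qed
next
  fix w w' :: "bool list" assume "w \<in> {w. length w = k}" "w' \<in> {w. length w = k}" "w \<noteq> w'"
  then show "branch_interval w \<inter> branch_interval w' = {}"
    by (intro branch_interval_disjoint) auto
qed

section \<open>The cube in the word metric\<close>

text \<open>Adding \<open>i\<close> is right multiplication by \<open>g i\<close>, so left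
  invariance leaves just the length of \<open>g i\<close>; removing \<open>i\<close> is the same
  edge backwards.\<close>

lemma (in disjoint_bumps) wdist_bump_product_flip:
  assumes "generated_group thompson_F S" "A \<subseteq> I" "i \<in> I"
  shows "word_dist thompson_F S (bump_product A) (bump_product (flip i A)) = word_length thompson_F S (g i)"
proof -
  interpret G: generated_group thompson_F S by fact
  have le: "word_dist thompson_F S (bump_product B) (bump_product (insert i B)) = word_length thompson_F S (g i)"
    if "B \<subseteq> I" "i \<notin> B" for B
    using bump_product_carrier[OF that(1)] g_carrier[OF assms(3)]
    unfolding word_dist_def bump_product_insert_mult[OF that(1) assms(3) that(2)]
    by (simp flip: G.m_assoc)
  show ?thesis
  proof (cases "i \<in> A")
    case True
    then have "flip i A = A - {i}" "insert i (A - {i}) = A" unfolding flip_def by auto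
    then show ?thesis
      using le[of "A - {i}"] G.wdist_commute bump_product_carrier assms(2)
      by (metis Diff_iff Diff_subset insertI1 subset_trans)
  next
    case False
    then have "flip i A = insert i A" unfolding flip_def by auto
    then show ?thesis using le[OF assms(2) False] by simp
  qed
qed

text \<open>The words of length \<open>k\<close> index a cube of dimension \<open>2 ^ k\<close>.
  \<open>C\<close> measures how far two flips of a vertex lie apart per level, and \<open>M\<close>
  how many breakpoints a letter can create; neither depends on \<open>k\<close>.\<close>

lemma thompson_F_cube_bound:
  assumes gen: "generated_group thompson_F S" and "finite S"
  shows "\<exists>C>0. \<exists>M\<ge>1. \<forall>k r D n. C * real (k + 1) \<le> r \<longrightarrow>
    scale_dim_le (carrier thompson_F) (word_dist thompson_F S) r D n \<longrightarrow>
      2 ^ k \<le> nat \<lfloor>M * D\<rfloor> + (n + 1) * (nat \<lfloor>M * D\<rfloor> + 1)"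
proof -
  interpret G: generated_group thompson_F S by fact
  \<comment> \<open>Bounds the lengths of all three basic elements; the summand 1 makes the constant
    \<open>4 * L\<close> positive.\<close>
  define L where "L = 1 + G.len thompson_left + G.len thompson_right + G.len thompson_bump"
  have len_word: "G.len (branch_word w) \<le> length w * L" for w
  proof (induction w)
    case Nil
    then show ?case unfolding branch_word_def by simp
  next
    case (Cons b w)
    have "branch_word (b # w) = thompson_branch b \<otimes>\<^bsub>thompson_F\<^esub> branch_word w"
      unfolding branch_word_def by simp
    then have "G.len (branch_word (b # w)) \<le> G.len (thompson_branch b) + G.len (branch_word w)"
      using G.len_mult[OF thompson_branch_carrier branch_word_carrier] by simp
    moreover have "G.len (thompson_branch b) \<le> L" unfolding thompson_branch_def L_def by simp
    ultimately show ?case using Cons by simp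
  qed
  have len_bump: "G.len (branch_bump w) \<le> (2 * length w + 1) * L" for w
  proof -
    have "G.len (branch_bump w) \<le> G.len (branch_word w \<otimes>\<^bsub>thompson_F\<^esub> thompson_bump)
        + G.len (inv\<^bsub>thompson_F\<^esub> (branch_word w))"
      unfolding branch_bump_def
      using branch_word_carrier thompson_bump_carrier by (intro G.len_mult) auto
    also have "\<dots> \<le> G.len (branch_word w) + G.len thompson_bump + G.len (branch_word w)"
      using G.len_mult[OF branch_word_carrier thompson_bump_carrier, of w]
        G.len_inv[OF branch_word_carrier, of w] by simp
    also have "\<dots> \<le> length w * L + L + length w * L"
      using len_word[of w] unfolding L_def by simp
    finally show ?thesis by (simp add: algebra_simps)
  qed
  obtain M0 where M0: "\<And>ws. set ws \<subseteq> S \<union> m_inv thompson_F ` S \<Longrightarrow>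
      \<exists>P. finite P \<and> card P \<le> M0 * length ws \<and> affine_off P (foldr (mult thompson_F) ws \<one>\<^bsub>thompson_F\<^esub>)"
    using thompson_F_breakpoints_le_word[OF _ G.letters_closed[OF G.S_carrier]] \<open>finite S\<close> by blast
  define M where "M = real M0 + 1"
  have "2 ^ k \<le> nat \<lfloor>M * D\<rfloor> + (n + 1) * (nat \<lfloor>M * D\<rfloor> + 1)"
    if r: "real (4 * L) * real (k + 1) \<le> r"
      and dim: "scale_dim_le (carrier thompson_F) G.wdist r D n" for k r D n
  proof -
    interpret B: disjoint_bumps "{w. length w = k}" branch_interval branch_bump
      by (rule disjoint_bumps_branch)
    let ?I = "{w :: bool list. length w = k}"
    have "card ?I = 2 ^ k"
      using card_lists_length_eq[of "UNIV :: bool set" k] by simp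
    moreover have "card ?I \<le> nat \<lfloor>M * D\<rfloor> + (n + 1) * (nat \<lfloor>M * D\<rfloor> + 1)"
    proof (rule scale_dim_le_hypercube[OF B.fin B.bump_product_carrier G.wdist_commute _ _ _ dim])
      fix A i j assume A: "A \<subseteq> ?I" "i \<in> ?I" "j \<in> ?I"
      let ?b = "B.bump_product"
      have c: "?b A \<in> carrier thompson_F" "?b (flip i A) \<in> carrier thompson_F"
        "?b (flip j A) \<in> carrier thompson_F"
        using A flip_subset[of A ?I] by (intro B.bump_product_carrier; blast)+
      have "G.wdist (?b (flip i A)) (?b (flip j A)) \<le> G.wdist (?b A) (?b (flip i A)) + G.wdist (?b A) (?b (flip j A))"
        using G.wdist_triangle[OF c(2,1,3)] G.wdist_commute[OF c(1,2)] by simp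
      also have "\<dots> = real (G.len (branch_bump i) + G.len (branch_bump j))"
        using B.wdist_bump_product_flip[OF gen A(1)] A(2,3) by simp
      \<comment> \<open>Each bump has length at most \<open>(2 * k + 1) * L\<close>, and twice
        \<open>2 * k + 1\<close> is at most \<open>4 * (k + 1)\<close>.\<close>
      also have "G.len (branch_bump i) + G.len (branch_bump j) \<le> 4 * L * (k + 1)"
        using len_bump[of i] len_bump[of j] A(2,3) by (simp add: algebra_simps)
      then have "real (G.len (branch_bump i) + G.len (branch_bump j)) \<le> real (4 * L * (k + 1))"
        by (rule of_nat_mono)
      also have "\<dots> \<le> r" using r by (simp only: of_nat_mult)
      finally show "G.wdist (?b (flip i A)) (?b (flip j A)) \<le> r" .
    next
      fix A A' assume A: "A \<subseteq> ?I" "A' \<subseteq> ?I"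
      \<comment> \<open>Differing coordinates number at most the breakpoints of this quotient, hence
        at most \<open>M0\<close> times its length, which is the distance.\<close>
      let ?f = "inv\<^bsub>thompson_F\<^esub> (B.bump_product A) \<otimes>\<^bsub>thompson_F\<^esub> B.bump_product A'"
      have c: "B.bump_product A \<in> carrier thompson_F" "B.bump_product A' \<in> carrier thompson_F"
        using A by (auto intro: B.bump_product_carrier)
      then have f: "?f \<in> carrier thompson_F" by simp
      obtain ws where ws: "set ws \<subseteq> S \<union> m_inv thompson_F ` S"
        "foldr (mult thompson_F) ws \<one>\<^bsub>thompson_F\<^esub> = ?f" "length ws = G.len ?f"
        using f by (rule G.obtain_shortest_word)
      obtain P where P: "finite P" "card P \<le> M0 * length ws" "affine_off P ?f"
        using M0[OF ws(1)] ws(2) by auto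
      have "B.bump_product A \<otimes>\<^bsub>thompson_F\<^esub> ?f = B.bump_product A'"
        using c by (simp flip: G.m_assoc)
      then have "card (sym_diff A A') \<le> card P"
        using B.card_sym_diff_le[OF A f _ P(1,3)] by blast
      then have "card (sym_diff A A') \<le> M0 * G.len ?f" using P(2) ws(3) by simp
      then have "real (card (sym_diff A A')) \<le> real (M0 * G.len ?f)" by (rule of_nat_mono)
      also have "\<dots> \<le> M * G.wdist (B.bump_product A) (B.bump_product A')"
        unfolding word_dist_def M_def by (simp add: algebra_simps)
      finally show "real (card (sym_diff A A')) \<le> M * G.wdist (B.bump_product A) (B.bump_product A')" .
    qed (auto simp: M_def)
    ultimately show ?thesis by simp
  qed
  moreover have "real (4 * L) > 0" unfolding L_def by simp
  moreover have "M \<ge> 1" unfolding M_def by simp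
  ultimately show ?thesis by (intro exI[of _ "real (4 * L)"] exI[of _ M] conjI allI impI) assumption+
qed

section \<open>Comparison with the exponential function\<close>

theorem theorem5p6:
  fixes S :: "(real \<Rightarrow> real) set"
  assumes "finite S" and "S \<subseteq> carrier thompson_F" and "generate thompson_F S = carrier thompson_F"
  shows "\<exists>\<alpha>::real. \<alpha> > 0 \<and>
    same_growth
      (\<lambda>r. ereal_of_enat
        (controlled_dim (carrier thompson_F) (word_dist thompson_F S) (\<lambda>t. exp (\<alpha> * t)) r))
      (\<lambda>r. ereal (exp r))"
proof -
  have gen: "generated_group thompson_F S"
    using group_thompson_F assms(2,3) unfolding generated_group_def generated_group_axioms_def by blast
  interpret G: generated_group thompson_F S by (rule gen)
  let ?X = "carrier thompson_F"
  obtain C M where CM: "C > 0" "M \<ge> 1"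
    and cube: "\<forall>k r D n. C * real (k + 1) \<le> r \<longrightarrow> scale_dim_le ?X G.wdist r D n \<longrightarrow>
      2 ^ k \<le> nat \<lfloor>M * D\<rfloor> + (n + 1) * (nat \<lfloor>M * D\<rfloor> + 1)"
    using thompson_F_cube_bound[OF gen assms(1)] by (elim exE conjE)
  have "\<exists>\<alpha>>0. \<exists>\<beta>>0. \<exists>c. \<forall>r>0. ereal (exp (\<beta> * r) - c) \<le>
      ereal_of_enat (controlled_dim ?X G.wdist (\<lambda>t. exp (\<alpha> * t)) r)"
  proof (rule controlled_dim_exponential_lower[OF CM])
    fix k r D n assume "C * real (k + 1) \<le> r" "scale_dim_le ?X G.wdist r D n"
    then show "2 ^ k \<le> nat \<lfloor>M * D\<rfloor> + (n + 1) * (nat \<lfloor>M * D\<rfloor> + 1)"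
      by (rule cube[THEN spec, THEN spec, THEN spec, THEN spec, THEN mp, THEN mp])
  qed
  then obtain \<alpha> \<beta> c where \<alpha>\<beta>: "\<alpha> > 0" "\<beta> > 0"
    and lower: "\<forall>r>0. ereal (exp (\<beta> * r) - c) \<le>
      ereal_of_enat (controlled_dim ?X G.wdist (\<lambda>t. exp (\<alpha> * t)) r)"
    by (elim exE conjE)
  let ?f = "\<lambda>r. ereal_of_enat (controlled_dim ?X G.wdist (\<lambda>t. exp (\<alpha> * t)) r)"
  let ?u = "ln (real (2 * card S + 1))"
  \<comment> \<open>Stretching by \<open>1 / \<beta>\<close> lifts the lower rate
    \<open>\<beta>\<close> to 1, and \<open>?u\<close> is the rate of the upper bound.\<close>
  define a where "a = max (1 / \<beta>) (max 1 ?u)"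
  \<comment> \<open>The constant of the lower bound may be negative, whereas
    \<open>same_growth\<close> asks for a positive one.\<close>
  define c' where "c' = max 1 c"
  have "c' > 0" unfolding c'_def by simp
  have "1 / \<beta> \<le> a" "1 \<le> a" and ua: "?u \<le> a" unfolding a_def by linarith+
  then have a: "a > 0" "1 \<le> \<beta> * a" using \<alpha>\<beta>(2) by (simp_all add: field_simps)
  have "?f (a * t) \<ge> ereal (exp t) - ereal c' \<and> ereal (exp (a * t)) \<ge> ?f t - ereal c'" if "t > 0" for t
  proof
    have "1 * t \<le> (\<beta> * a) * t" using a(2) that by (intro mult_right_mono) auto
    then have "exp t \<le> exp (\<beta> * (a * t))" by (simp add: mult.assoc)
    then have "exp t - c' \<le> exp (\<beta> * (a * t)) - c" unfolding c'_def by linarith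
    then have "ereal (exp t - c') \<le> ereal (exp (\<beta> * (a * t)) - c)" by simp
    also have "\<dots> \<le> ?f (a * t)" using lower a(1) that by simp
    finally show "ereal (exp t) - ereal c' \<le> ?f (a * t)" by simp
    \<comment> \<open>Here the exponential is the stretched function, so the bound on ball sizes
      suffices; subtracting \<open>c'\<close> only decreases the other side.\<close>
    have "?f t \<le> ereal (exp (?u * t))"
      using assms(1) that by (intro G.controlled_dim_upper) auto
    also have "\<dots> \<le> ereal (exp (a * t))" using ua that by (simp add: mult_right_mono)
    finally have "?f t \<le> ereal (exp (a * t))" .
    moreover have "?f t - ereal c' \<le> ?f t"
      using ereal_minus_mono[of "?f t" "?f t" 0 "ereal c'"] \<open>c' > 0\<close> by simp
    ultimately show "?f t - ereal c' \<le> ereal (exp (a * t))" by (rule order_trans[rotated])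
  qed
  then have "same_growth ?f (\<lambda>r. ereal (exp r))"
    unfolding same_growth_def using a(1) \<open>c' > 0\<close> by blast
  with \<alpha>\<beta>(1) show ?thesis by blast
qed

end
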